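(* Let $n$ and $\delta$ be positive integers, write $\delta=(1-\beta)n$ with $0<\beta<1$, and let $p=\lceil\beta^{-1}\rceil-1$. Let $G$ be a $K_{p+2}$-free graph of order $n$ with minimum degree $\delta$. Then $k_r(G)\ge g_r(\beta)n^r$ for every positive integer $r$. Moreover, for $3\le r\le p+1$, equality $k_r(G)=g_r(\beta)n^r$ holds if and only if $(n,\beta)$ is feasible and $G\in\mathcal{G}(n,\beta)$.
   Context: All graphs are finite and simple; $k_r(G)$ is the number of $r$-cliques of $G$. Throughout, $\delta=(1-\beta)n$ with $0<\beta<1$, and $p=\lceil \beta^{-1}\rceil-1$, so $1/(p+1)\le \beta<1/p$. For such $\beta$ and integers $r$, define $$g_r(\beta)=\binom{p-1}{r}\beta^{r}+\binom{p-1}{r-1}(1-(p-1)\beta)\beta^{r-1}+\frac12\binom{p-1}{r-2}(1-p\beta)(1-(p-1)\beta)\beta^{r-2},$$ where $p=\lceil\beta^{-1}\rceil-1$ and $\binom{x}{y}=0$ if $x<y$ or $y<0$. The family $\mathcal{G}(n,\beta)$ (defined only when $n$ and $(1-\beta)n$ are positive integers not both odd, $0<\beta<1$) consists of all graphs $G$ on vertex set $V$ with $|V|=n$ for which there is a partition $V=V_0\cup V_1\cup\dots\cup V_{p-1}$ with $|V_0|=(1-(p-1)\beta)n$ and $|V_i|=\beta n$ for $1\le i\le p-1$, such that: for $0\le i<j\le p-1$ every vertex of $V_i$ is adjacent to every vertex of $V_j$; for $1\le i\le p-1$, $V_i$ is an independent set; and $G[V_0]$ is a $(1-p\beta)n$-regular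 graph whose number of triangles is minimum among all $(1-p\beta)n$-regular graphs on $|V_0|$ vertices. The pair $(n,\beta)$ is called feasible if $\mathcal{G}(n,\beta)$ is defined and $G[V_0]$ is triangle-free for $G\in\mathcal{G}(n,\beta)$. *)

theory Defs
  imports Complex_Main
begin

definition sgraph :: "'a set \<Rightarrow> ('a \<Rightarrow> 'a \<Rightarrow> bool) \<Rightarrow> bool" where
  "sgraph V E \<longleftrightarrow> finite V \<and> (\<forall>x y. E x y \<longrightarrow> x \<in> V \<and> y \<in> V)
     \<and> (\<forall>x y. E x y \<longrightarrow> E y x) \<and> (\<forall>x. \<not> E x x)"

definition clique :: "('a \<Rightarrow> 'a \<Rightarrow> bool) \<Rightarrow> 'a set \<Rightarrow> bool" where
  "clique E S \<longleftrightarrow> (\<forall>x\<in>S. \<forall>y\<in>S. x \<noteq> y \<longrightarrow> E x y)"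

text \<open>Number of r-cliques of the graph (V,E) (also used for induced subgraphs G[W]).\<close>
definition kr :: "'a set \<Rightarrow> ('a \<Rightarrow> 'a \<Rightarrow> bool) \<Rightarrow> nat \<Rightarrow> nat" where
  "kr V E r = card {S. S \<subseteq> V \<and> card S = r \<and> clique E S}"

definition degree :: "'a set \<Rightarrow> ('a \<Rightarrow> 'a \<Rightarrow> bool) \<Rightarrow> 'a \<Rightarrow> nat" where
  "degree V E v = card {u \<in> V. E v u}"

definition min_degree_is :: "'a set \<Rightarrow> ('a \<Rightarrow> 'a \<Rightarrow> bool) \<Rightarrow> nat \<Rightarrow> bool" where
  "min_degree_is V E d \<longleftrightarrow> (\<forall>v\<in>V. d \<le> degree V E v) \<and> (\<exists>v\<in>V. degree V E v = d)"

definition clique_free :: "'a set \<Rightarrow> ('a \<Rightarrow> 'a \<Rightarrow> bool) \<Rightarrow> nat \<Rightarrow> bool" where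
  "clique_free V E s \<longleftrightarrow> \<not> (\<exists>S. S \<subseteq> V \<and> card S = s \<and> clique E S)"

definition pval :: "real \<Rightarrow> int" where
  "pval \<beta> = \<lceil>1 / \<beta>\<rceil> - 1"

definition binom :: "int \<Rightarrow> int \<Rightarrow> real" where
  "binom x y = (if y < 0 \<or> x < y then 0 else real (nat x choose nat y))"

definition g :: "nat \<Rightarrow> real \<Rightarrow> real" where
  "g r \<beta> = (let p = pval \<beta> in
      binom (p - 1) (int r) * \<beta> ^ r
    + binom (p - 1) (int r - 1) * (1 - of_int (p - 1) * \<beta>) * \<beta> powi (int r - 1)
    + 1/2 * binom (p - 1) (int r - 2) * (1 - of_int p * \<beta>) * (1 - of_int (p - 1) * \<beta>)
        * \<beta> powi (int r - 2))"

text \<open>The family G(n,beta) is defined when n and (1-beta)n = delta are positive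
integers, not both odd, and 0 < beta < 1 (i.e. 0 < delta < n).\<close>
definition family_defined :: "nat \<Rightarrow> nat \<Rightarrow> bool" where
  "family_defined n \<delta> \<longleftrightarrow> 0 < \<delta> \<and> \<delta> < n \<and> \<not> (odd n \<and> odd \<delta>)"

definition regular_graph :: "'b set \<Rightarrow> ('b \<Rightarrow> 'b \<Rightarrow> bool) \<Rightarrow> real \<Rightarrow> bool" where
  "regular_graph W H d \<longleftrightarrow> sgraph W H \<and> (\<forall>v\<in>W. real (degree W H v) = d)"

definition family_witness ::
  "nat \<Rightarrow> nat \<Rightarrow> 'a set \<Rightarrow> ('a \<Rightarrow> 'a \<Rightarrow> bool) \<Rightarrow> (nat \<Rightarrow> 'a set) \<Rightarrow> bool" where
  "family_witness n \<delta> V E P \<longleftrightarrow>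
     (let \<beta> = 1 - real \<delta> / real n; p = nat (pval \<beta>) in
       sgraph V E \<and> card V = n \<and>
       V = (\<Union>i<p. P i) \<and>
       (\<forall>i<p. \<forall>j<p. i \<noteq> j \<longrightarrow> P i \<inter> P j = {}) \<and>
       real (card (P 0)) = (1 - real (p - 1) * \<beta>) * real n \<and>
       (\<forall>i. 1 \<le> i \<and> i < p \<longrightarrow> real (card (P i)) = \<beta> * real n) \<and>
       (\<forall>i j. i < j \<and> j < p \<longrightarrow> (\<forall>x\<in>P i. \<forall>y\<in>P j. E x y)) \<and>
       (\<forall>i. 1 \<le> i \<and> i < p \<longrightarrow> (\<forall>x\<in>P i. \<forall>y\<in>P i. \<not> E x y)) \<and>
       (\<forall>v\<in>P 0. real (degree (P 0) E v) = (1 - real p * \<beta>) * real n) \<and>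
       (\<forall>H :: nat \<Rightarrow> nat \<Rightarrow> bool.
          regular_graph {0..<card (P 0)} H ((1 - real p * \<beta>) * real n) \<longrightarrow>
          kr (P 0) E 3 \<le> kr {0..<card (P 0)} H 3))"

definition in_family :: "nat \<Rightarrow> nat \<Rightarrow> 'a set \<Rightarrow> ('a \<Rightarrow> 'a \<Rightarrow> bool) \<Rightarrow> bool" where
  "in_family n \<delta> V E \<longleftrightarrow> family_defined n \<delta> \<and> (\<exists>P. family_witness n \<delta> V E P)"

text \<open>(n,beta) feasible: G(n,beta) is defined and G[V_0] is triangle-free for every
G in G(n,beta) (graphs on the vertex set {0..<n}; up to isomorphism this is all of them).\<close>
definition feasible :: "nat \<Rightarrow> nat \<Rightarrow> bool" where
  "feasible n \<delta> \<longleftrightarrow> family_defined n \<delta> \<and>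
     (\<forall>(E :: nat \<Rightarrow> nat \<Rightarrow> bool) P. family_witness n \<delta> {0..<n} E P \<longrightarrow> kr (P 0) E 3 = 0)"

end

(* Let b = n - \<delta> and let D(T) be the number of common neighbours of a t-clique T. Every vertex
   has at most b non-neighbours and G is K_{p+2}-free, so n - t b \<le> D(T) \<le> (p + 1 - t) b.
   In a (t+1)-clique S, counting the neighbours in S of every vertex of G gives
   \<Sum>_{x\<in>S} D(S - x) \<ge> 2 n - (t+1) b + (t-1) D(S). Summing over S turns the left side into
   \<Sum>_T D(T)^2, which the two bounds on D(T) estimate from above by a linear function of D(T).
   The result is a linear inequality between k_t, k_{t+1}, k_{t+2}, and g satisfies the same relation
   with equality. For the ratios \<rho>_t = k_t / (g_t n^t) it reads
   u_t (\<rho>_{t+1} - \<rho>_t) \<ge> w_t (\<rho>_{t+2} - \<rho>_{t+1}) with w_p = 0, so \<rho> is nondecreasing by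
   downward induction, and \<rho>_1 = 1.
   Equality for one r \<ge> 3 propagates to all ratios up to p + 1. Then G is regular and D(T) is n - p b
   or b for each p-clique T, and a (p+1)-clique S has at least p - 1 vertices x for which the common
   neighbourhood of S - x has size b; these neighbourhoods are the independent parts. *)
theory Submission
  imports Defs
begin

section \<open>Closed forms, recurrence and sign of the extremal densities\<close>

section \<open>The numbers g\<close>

lemma choose_Suc_ratio: "real (Suc j) * real (m choose Suc j) = (real m - real j) * real (m choose j)"
proof (cases "j \<le> m")
  case True
  have "Suc j * (m choose Suc j) = (m - j) * (m choose j)"
    by (metis Suc_times_binomial_eq binomial_absorb_comp binomial_absorption mult.commute)
  then show ?thesis using True by (metis of_nat_diff of_nat_mult)
qed (simp add: binomial_eq_0)

text \<open>\<open>g\<close> has integer exponents and binomials that may be negative. From index 2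
  on all of them are natural numbers, so the conventions for \<open>binom\<close> and
  \<open>powi\<close> disappear.\<close>

lemma g_Suc_Suc:
  assumes "pval \<beta> = int p" "1 \<le> p"
  shows "g (Suc (Suc j)) \<beta> = real ((p - 1) choose Suc (Suc j)) * \<beta> ^ Suc (Suc j)
    + real ((p - 1) choose Suc j) * (1 - real (p - 1) * \<beta>) * \<beta> ^ Suc j
    + 1/2 * real ((p - 1) choose j) * (1 - real p * \<beta>) * (1 - real (p - 1) * \<beta>) * \<beta> ^ j"
proof -
  have b: "binom (int p - 1) (int i) = real ((p - 1) choose i)" for i
    using assms(2) by (auto simp: binom_def nat_diff_distrib binomial_eq_0 of_nat_diff)
  have p: "real_of_int (int p - 1) = real (p - 1)" using assms(2) by simp
  have "int (Suc (Suc j)) - 1 = int (Suc j)" "int (Suc (Suc j)) - 2 = int j" by auto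
  then show ?thesis
    unfolding g_def Let_def assms(1) by (simp only: b p power_int_of_nat of_int_of_nat_eq)
qed

text \<open>This anchors the ratios at \<rho>_1 = 1. The summand with exponent -1 disappears because
  its binomial is 0 by convention.\<close>

lemma g_1:
  assumes "pval \<beta> = int p" "1 \<le> p"
  shows "g 1 \<beta> = 1"
proof -
  have "binom (int p - 1) 1 = real (p - 1)" "binom (int p - 1) 0 = 1" "binom (int p - 1) (-1) = 0"
    using assms(2) by (auto simp: binom_def nat_diff_distrib)
  then show ?thesis
    using assms by (simp add: g_def Let_def)
qed

text \<open>This is the edge density of a regular graph of degree (1 - \<beta>)n, which is how
  equality of edge numbers will detect regularity.\<close>

lemma g_2:
  assumes "pval \<beta> = int p" "1 \<le> p"
  shows "g 2 \<beta> = (1 - \<beta>) / 2"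
proof -
  obtain m where p: "p = Suc m" using assms(2) by (cases p) auto
  have "2 * real (m choose 2) = real m * (real m - 1)"
    using choose_Suc_ratio[of 1 m] by (simp add: numeral_2_eq_2 algebra_simps)
  then have c: "real (m choose 2) = real m * (real m - 1) / 2" by simp
  have "g 2 \<beta> = real (m choose 2) * \<beta>\<^sup>2 + real m * (1 - real m * \<beta>) * \<beta>
      + 1/2 * (1 - (real m + 1) * \<beta>) * (1 - real m * \<beta>)"
    using g_Suc_Suc[OF assms, of 0] by (simp add: p numeral_2_eq_2 algebra_simps)
  also have "\<dots> = (1 - \<beta>) / 2"
    unfolding c by (simp add: field_simps power2_eq_square)
  finally show ?thesis .
qed

text \<open>This is the relation \<open>gap t = 0\<close> with \<open>b\<close> = \<beta>n and
  clique numbers g_r n^r, divided by n^(t+2). It makes \<open>g\<close> the equality case of the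
  clique inequality.\<close>

lemma g_recurrence:
  fixes \<beta> :: real
  assumes "pval \<beta> = int p" "1 \<le> p" "1 \<le> t"
  shows "(1 - real t * \<beta>) * (real p + 1 - real t) * \<beta> * g t \<beta>
      + (real t - 1) * (real t + 2) * g (t + 2) \<beta>
    = (real t - 1 + (real p + 2 - 2 * real t) * (real t + 1) * \<beta>) * g (t + 1) \<beta>"
proof (cases "t = 1")
  case True
  \<comment> \<open>\<open>g 1\<close> is outside the shifted closed form; here the coefficient of
    \<open>g 3\<close> is 0.\<close>
  show ?thesis
    unfolding True using g_1[OF assms(1,2)] g_2[OF assms(1,2)] by (simp add: numeral_2_eq_2)
next
  case False
  then obtain j where t: "t = Suc (Suc j)" using assms(3) by (intro that[of "t - 2"]) arith
  obtain m where p: "p = Suc m" using assms(2) by (cases p) auto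
  \<comment> \<open>With \<open>C\<close> = 1 - (p-1)\<beta>, and so 1 - p\<beta> = C - \<beta>,
    each \<open>g\<close> becomes a power of \<beta> times a quadratic form in \<open>C\<close> and
    \<beta>.\<close>
  define J N where "J = real j" and "N = real m - J"
  define C where "C = 1 - real m * \<beta>"
  define b where "b i = real (m choose (i + j))" for i
  have "(J + real i + 1) * b (i + 1) = (N - real i) * b i" for i
    using choose_Suc_ratio[of "i + j" m] by (simp add: b_def J_def N_def algebra_simps)
  from this[of 0] this[of 1] this[of 2] this[of 3]
  have R: "(J + 1) * b 1 = N * b 0" "(J + 2) * b 2 = (N - 1) * b 1"
    "(J + 3) * b 3 = (N - 2) * b 2" "(J + 4) * b 4 = (N - 3) * b 3"
    by (simp_all add: numeral_2_eq_2[symmetric] add.assoc)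
  define F where "F = 2 * N * J + 4 * N - 3 * J - 3"
  have G: "g (2 + j + i) \<beta> = \<beta> ^ i * \<beta> ^ j *
      (b i * C\<^sup>2 + (2 * b (i + 1) - b i) * C * \<beta> + 2 * b (i + 2) * \<beta>\<^sup>2) / 2" for i
  proof -
    have "1 - real p * \<beta> = C - \<beta>" "1 - real (p - 1) * \<beta> = C" by (simp_all add: C_def p algebra_simps)
    then have "g (Suc (Suc (i + j))) \<beta> = b (i + 2) * \<beta> ^ Suc (Suc (i + j)) + b (i + 1) * C * \<beta> ^ Suc (i + j)
        + 1/2 * b i * (C - \<beta>) * C * \<beta> ^ (i + j)"
      using g_Suc_Suc[OF assms(1,2), of "i + j"] by (simp only:) (simp add: p b_def)
    then show ?thesis
      by (simp add: power2_eq_square power_add field_simps)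
  qed
  \<comment> \<open>The target is an identity of cubic forms in \<open>C\<close> and \<beta>. These
    four facts compare the coefficients of C^3, C^2 \<beta>, C \<beta>^2 and \<beta>^3.\<close>
  have "N * b 0 = (J + 1) * b 1" using R by simp
  moreover have "N * (2 * b 1 - b 0) + (N - 2) * N * b 0 + (J + 1) * (J + 4) * b 2 = (J + 1) * (2 * b 2 - b 1) + F * b 1"
    using R(1,2) unfolding F_def by algebra
  moreover have "2 * N * b 2 + (N - 2) * N * (2 * b 1 - b 0) + (J + 1) * (J + 4) * (2 * b 3 - b 2)
      = (J + 1) * 2 * b 3 + F * (2 * b 2 - b 1)"
    using R(1-3) unfolding F_def by algebra
  moreover have "(N - 2) * N * 2 * b 2 + (J + 1) * (J + 4) * 2 * b 4 = F * 2 * b 3"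
    using R(3,4) unfolding F_def by algebra
  ultimately have "(C + (N - 2) * \<beta>) * N * (b 0 * C\<^sup>2 + (2 * b 1 - b 0) * C * \<beta> + 2 * b 2 * \<beta>\<^sup>2)
      + (J + 1) * (J + 4) * \<beta> * (b 2 * C\<^sup>2 + (2 * b 3 - b 2) * C * \<beta> + 2 * b 4 * \<beta>\<^sup>2)
     = ((J + 1) * C + F * \<beta>) * (b 1 * C\<^sup>2 + (2 * b 2 - b 1) * C * \<beta> + 2 * b 3 * \<beta>\<^sup>2)"
    (is "?L0 * ?Q0 + ?L2 * ?Q2 = ?L1 * ?Q1")
    by algebra
  moreover have "1 - real t * \<beta> = C + (N - 2) * \<beta>" "real p + 1 - real t = N" "real t - 1 = J + 1" "real t + 2 = J + 4"
    "real t - 1 + (real p + 2 - 2 * real t) * (real t + 1) * \<beta> = (J + 1) * C + F * \<beta>"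
    by (simp_all add: t p C_def N_def J_def F_def algebra_simps)
  moreover have "g t \<beta> = \<beta> ^ j * ?Q0 / 2" "g (t + 1) \<beta> = \<beta> ^ Suc j * ?Q1 / 2" "g (t + 2) \<beta> = \<beta> ^ Suc (Suc j) * ?Q2 / 2"
    using G[of 0] G[of 1] G[of 2] by (simp_all add: t numeral_eq_Suc)
  moreover have "?L0 * \<beta> * (\<beta> ^ j * ?Q0 / 2) + (J + 1) * (J + 4) * (\<beta> ^ Suc (Suc j) * ?Q2 / 2)
    = \<beta> ^ Suc j / 2 * (?L0 * ?Q0 + ?L2 * ?Q2)" by (simp add: field_simps)
  ultimately show ?thesis by (simp only: times_divide_eq_left times_divide_eq_right mult_ac)
qed

text \<open>All summands are nonnegative, and the last one is positive because t - 2 does not exceed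
  p - 1 and p\<beta> < 1.\<close>

lemma g_pos:
  assumes "pval \<beta> = int p" "1 \<le> p" "0 < \<beta>" "real p * \<beta> < 1" "1 \<le> t" "t \<le> p + 1"
  shows "0 < g t \<beta>"
proof (cases "t = 1")
  case True
  then show ?thesis using g_1[OF assms(1,2)] by simp
next
  case False
  then obtain j where t: "t = Suc (Suc j)" using assms(5) by (intro that[of "t - 2"]) arith
  have "real (p - 1) * \<beta> < 1"
    using mult_right_mono[of "real (p - 1)" "real p" \<beta>] assms(3,4) by linarith
  moreover have "0 < (p - 1) choose j" using assms(6) t by simp
  ultimately show ?thesis
    unfolding t g_Suc_Suc[OF assms(1,2)] using assms(3,4)
    by (intro add_nonneg_pos add_nonneg_nonneg mult_nonneg_nonneg mult_pos_pos) auto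
qed

lemma g_eq_0:
  assumes "pval \<beta> = int p" "1 \<le> p" "p + 2 \<le> t"
  shows "g t \<beta> = 0"
proof -
  obtain j where t: "t = Suc (Suc j)" using assms(3) by (intro that[of "t - 2"]) arith
  show ?thesis unfolding t g_Suc_Suc[OF assms(1,2)] using assms(2,3) by (simp add: t binomial_eq_0)
qed

text \<open>At \<open>p\<close> the left side of the inequality is 0, so the last increment is
  nonnegative. The inequality then passes the sign from each increment to the preceding one.\<close>

lemma incseq_of_weighted_concave:
  fixes \<rho> u w :: "nat \<Rightarrow> real"
  assumes "\<And>t. 1 \<le> t \<Longrightarrow> t \<le> p \<Longrightarrow> 0 < u t" "\<And>t. 1 \<le> t \<Longrightarrow> t \<le> p \<Longrightarrow> 0 \<le> w t" "w p = 0"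
    and ineq: "\<And>t. 1 \<le> t \<Longrightarrow> t \<le> p \<Longrightarrow> w t * (\<rho> (t + 2) - \<rho> (t + 1)) \<le> u t * (\<rho> (t + 1) - \<rho> t)"
    and "1 \<le> t" "t \<le> p"
  shows "\<rho> t \<le> \<rho> (t + 1)"
  using assms(6) assms(5)
proof (induction t rule: inc_induct)
  case base
  then show ?case using assms(1)[of p] ineq[of p] assms(3) by (simp add: zero_le_mult_iff)
next
  case (step t)
  then have "0 \<le> w t * (\<rho> (t + 2) - \<rho> (t + 1))" using assms(2)[of t] by simp
  then have "0 \<le> u t * (\<rho> (t + 1) - \<rho> t)" using ineq[of t] step by linarith
  then show ?case using assms(1)[of t] step by (simp add: zero_le_mult_iff)
qed

section \<open>Double counting of cliques and common neighbourhoods\<close>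

section \<open>Counting cliques by common neighbours\<close>

definition cliques :: "'a set \<Rightarrow> ('a \<Rightarrow> 'a \<Rightarrow> bool) \<Rightarrow> nat \<Rightarrow> 'a set set" where
  "cliques V E r = {S. S \<subseteq> V \<and> card S = r \<and> clique E S}"

definition common_nbrs :: "'a set \<Rightarrow> ('a \<Rightarrow> 'a \<Rightarrow> bool) \<Rightarrow> 'a set \<Rightarrow> 'a set" where
  "common_nbrs V E T = {v \<in> V. \<forall>x\<in>T. E x v}"

text \<open>In a simple graph a vertex belongs to its own set of non-neighbours, so the size is n
  minus the degree.\<close>

definition non_nbrs :: "'a set \<Rightarrow> ('a \<Rightarrow> 'a \<Rightarrow> bool) \<Rightarrow> 'a \<Rightarrow> 'a set" where
  "non_nbrs V E x = {v \<in> V. \<not> E x v}"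

lemma kr_eq_card_cliques: "kr V E r = card (cliques V E r)"
  by (simp add: kr_def cliques_def)

lemma clique_mono: "clique E S \<Longrightarrow> T \<subseteq> S \<Longrightarrow> clique E T"
  by (auto simp: clique_def)

locale simple_graph =
  fixes V :: "'a set" and E :: "'a \<Rightarrow> 'a \<Rightarrow> bool"
  assumes sgraph: "sgraph V E"
begin

abbreviation "K \<equiv> cliques V E"
abbreviation "N \<equiv> common_nbrs V E"
abbreviation "nonN \<equiv> non_nbrs V E"

lemma finite_V [simp]: "finite V" and E_sym: "E x y \<Longrightarrow> E y x" and E_irrefl [simp]: "\<not> E x x"
  using sgraph unfolding sgraph_def by blast+

lemma finite_cliques [simp]: "finite (K r)"
  by (rule finite_subset[of _ "Pow V"]) (auto simp: cliques_def)

lemma finite_N [simp]: "finite (N T)" and finite_nonN [simp]: "finite (nonN x)"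
  by (simp_all add: common_nbrs_def non_nbrs_def)

lemma finite_in_cliques: "S \<in> K r \<Longrightarrow> finite S"
  by (auto simp: cliques_def intro: finite_subset)

lemma common_nbrs_notin: "v \<in> N T \<Longrightarrow> v \<notin> T"
  by (auto simp: common_nbrs_def)

lemma insert_in_cliques: "T \<in> K t \<Longrightarrow> v \<in> N T \<Longrightarrow> insert v T \<in> K (Suc t)"
  using finite_in_cliques[of T t] common_nbrs_notin[of v T] E_sym[of _ v]
  by (auto simp: cliques_def common_nbrs_def clique_def)

lemma remove_in_cliques: "S \<in> K (Suc t) \<Longrightarrow> x \<in> S \<Longrightarrow> S - {x} \<in> K t"
  using finite_in_cliques[of S] by (auto simp: cliques_def clique_def)

lemma in_common_nbrs_remove: "S \<in> K t \<Longrightarrow> x \<in> S \<Longrightarrow> x \<in> N (S - {x})"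
  by (auto simp: cliques_def clique_def common_nbrs_def)

text \<open>Pairs of a clique S and a vertex x in S correspond to pairs of a smaller clique T and a
  common neighbour of T. Taking for \<open>f\<close> the size of \<open>N T\<close> produces a sum
  of squares.\<close>

lemma sum_cliques_remove:
  fixes f :: "'a set \<Rightarrow> real"
  shows "(\<Sum>S\<in>K (Suc t). \<Sum>x\<in>S. f (S - {x})) = (\<Sum>T\<in>K t. real (card (N T)) * f T)"
proof -
  have "(\<Sum>S\<in>K (Suc t). \<Sum>x\<in>S. f (S - {x})) = (\<Sum>(S,x)\<in>Sigma (K (Suc t)) (\<lambda>S. S). f (S - {x}))"
    by (rule sum.Sigma) (auto intro: finite_in_cliques)
  also have "\<dots> = (\<Sum>(T,v)\<in>Sigma (K t) N. f T)"
    by (rule sum.reindex_bij_witness[of _ "\<lambda>(T,v). (insert v T, v)" "\<lambda>(S,x). (S - {x}, x)"])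
      (auto simp: insert_absorb intro: remove_in_cliques insert_in_cliques in_common_nbrs_remove
        dest: common_nbrs_notin)
  also have "\<dots> = (\<Sum>T\<in>K t. \<Sum>v\<in>N T. f T)"
    by (rule sum.Sigma[symmetric]) auto
  finally show ?thesis by simp
qed

lemma sum_card_common_nbrs: "(\<Sum>T\<in>K t. real (card (N T))) = real (Suc t) * real (kr V E (Suc t))"
proof -
  have "(\<Sum>T\<in>K t. real (card (N T))) = (\<Sum>S\<in>K (Suc t). \<Sum>x\<in>S. 1)"
    using sum_cliques_remove[of "\<lambda>_. 1" t] by simp
  also have "\<dots> = (\<Sum>S\<in>K (Suc t). real (Suc t))"
    by (rule sum.cong) (auto simp: cliques_def)
  finally show ?thesis by (simp add: kr_eq_card_cliques)
qed

lemma card_nonN: 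
  assumes "x \<in> V" shows "degree V E x + card (nonN x) = card V"
proof -
  have "V = {u\<in>V. E x u} \<union> nonN x" by (auto simp: non_nbrs_def)
  moreover have "card ({u\<in>V. E x u} \<union> nonN x) = degree V E x + card (nonN x)"
    unfolding degree_def by (rule card_Un_disjoint) (auto simp: non_nbrs_def)
  ultimately show ?thesis by simp
qed

text \<open>The right-hand side is 0, 1 or t + 1 according as v has fewer than t, exactly t or all t + 1
  elements of S as neighbours; the left-hand side is affine in i and in the indicator of common
  adjacency, so that it can be summed over v.\<close>
lemma remove_weight:
  assumes S: "S \<in> K (Suc t)" and t: "1 \<le> t" and v: "v \<in> V"
  defines "i \<equiv> card {x\<in>S. E x v}"
  shows "real i - (real t - 1) + (real t - 1) * of_bool (v \<in> N S) \<le> real (card {x\<in>S. v \<in> N (S - {x})})"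
    and "t \<le> i + 1 \<Longrightarrow> real i - (real t - 1) + (real t - 1) * of_bool (v \<in> N S) = real (card {x\<in>S. v \<in> N (S - {x})})"
proof -
  have fin: "finite S" and cS: "card S = Suc t" using S finite_in_cliques[OF S] by (auto simp: cliques_def)
  have le: "i \<le> Suc t" unfolding i_def cS[symmetric] using fin by (intro card_mono) auto
  consider "i = Suc t" | "i = t" | "i < t" using le by linarith
  then have "real i - (real t - 1) + (real t - 1) * of_bool (v \<in> N S) \<le> real (card {x\<in>S. v \<in> N (S - {x})})
    \<and> (t \<le> i + 1 \<longrightarrow> real i - (real t - 1) + (real t - 1) * of_bool (v \<in> N S) = real (card {x\<in>S. v \<in> N (S - {x})}))"
  proof cases
    case 1
    then have "{x\<in>S. E x v} = S" using fin cS unfolding i_def by (intro card_subset_eq) auto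
    then have all: "\<forall>x\<in>S. E x v" by auto
    then have "v \<in> N S" "{x\<in>S. v \<in> N (S - {x})} = S" using v by (auto simp: common_nbrs_def)
    then show ?thesis using 1 cS by simp
  next
    case 2
    have "card (S - {x\<in>S. E x v}) = 1"
      using 2 fin cS unfolding i_def by (subst card_Diff_subset) auto
    then obtain y where y: "S - {x\<in>S. E x v} = {y}" by (auto simp: card_1_singleton_iff)
    then have y': "y \<in> S" "\<not> E y v" "\<And>x. x \<in> S \<Longrightarrow> x \<noteq> y \<Longrightarrow> E x v" by blast+
    then have "v \<notin> N S" "{x\<in>S. v \<in> N (S - {x})} = {y}" using v by (auto simp: common_nbrs_def)
    then show ?thesis using 2 by simp
  next
    case 3
    have "\<not> v \<in> N (S - {x})" if "x \<in> S" for x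
    proof
      assume "v \<in> N (S - {x})"
      then have "S - {x} \<subseteq> {x\<in>S. E x v}" by (auto simp: common_nbrs_def)
      then have "card (S - {x}) \<le> i" unfolding i_def using fin by (intro card_mono) auto
      then show False using 3 that fin cS by simp
    qed
    then have e: "{x\<in>S. v \<in> N (S - {x})} = {}" by auto
    have "v \<notin> N S"
    proof
      assume "v \<in> N S"
      then have "{x\<in>S. E x v} = S" by (auto simp: common_nbrs_def)
      then show False using 3 cS unfolding i_def by simp
    qed
    then show ?thesis unfolding e using 3 by auto
  qed
  then show "real i - (real t - 1) + (real t - 1) * of_bool (v \<in> N S) \<le> real (card {x\<in>S. v \<in> N (S - {x})})"
    and "t \<le> i + 1 \<Longrightarrow> real i - (real t - 1) + (real t - 1) * of_bool (v \<in> N S) = real (card {x\<in>S. v \<in> N (S - {x})})"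
    by auto
qed

text \<open>Exchanging the sums over \<open>V\<close> and \<open>S\<close> turns both sides of
  \<open>remove_weight\<close> into degrees and sizes of common neighbourhoods.\<close>

lemma sum_remove_weight:
  assumes S: "S \<in> K (Suc t)"
  shows "(\<Sum>v\<in>V. real (card {x\<in>S. E x v}) - (real t - 1) + (real t - 1) * of_bool (v \<in> N S))
      = (\<Sum>x\<in>S. real (degree V E x)) - (real t - 1) * real (card V) + (real t - 1) * real (card (N S))"
    and "(\<Sum>v\<in>V. real (card {x\<in>S. v \<in> N (S - {x})})) = (\<Sum>x\<in>S. real (card (N (S - {x}))))"
proof -
  have fin: "finite S" by (rule finite_in_cliques[OF S])
  have swap: "(\<Sum>v\<in>V. real (card {x\<in>S. P x v})) = (\<Sum>x\<in>S. real (card {v\<in>V. P x v}))" for P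
  proof -
    have "(\<Sum>v\<in>V. real (card {x\<in>S. P x v})) = (\<Sum>v\<in>V. \<Sum>x\<in>S. of_bool (P x v))"
      using fin by (intro sum.cong refl) (simp add: sum_of_bool_eq Int_def)
    also have "\<dots> = (\<Sum>x\<in>S. \<Sum>v\<in>V. of_bool (P x v))" by (rule sum.swap)
    also have "\<dots> = (\<Sum>x\<in>S. real (card {v\<in>V. P x v}))"
      by (intro sum.cong refl) (simp add: sum_of_bool_eq Int_def)
    finally show ?thesis .
  qed
  have "N S = {v\<in>V. v \<in> N S}" by (auto simp: common_nbrs_def)
  then have "(\<Sum>v\<in>V. of_bool (v \<in> N S)) = real (card (N S))"
    by (simp add: sum_of_bool_eq Int_def)
  then show "(\<Sum>v\<in>V. real (card {x\<in>S. E x v}) - (real t - 1) + (real t - 1) * of_bool (v \<in> N S))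
      = (\<Sum>x\<in>S. real (degree V E x)) - (real t - 1) * real (card V) + (real t - 1) * real (card (N S))"
    using swap[of E] by (simp add: sum.distrib sum_subtractf sum_distrib_left[symmetric] degree_def algebra_simps)
  have "{v\<in>V. v \<in> N (S - {x})} = N (S - {x})" for x by (auto simp: common_nbrs_def)
  then show "(\<Sum>v\<in>V. real (card {x\<in>S. v \<in> N (S - {x})})) = (\<Sum>x\<in>S. real (card (N (S - {x}))))"
    using swap[of "\<lambda>x v. v \<in> N (S - {x})"] by simp
qed

end

section \<open>The inequality between three consecutive clique numbers\<close>

locale clique_free_graph = simple_graph +
  fixes n b p :: nat
  assumes card_V: "card V = n"
    and card_nonN_le: "x \<in> V \<Longrightarrow> card (nonN x) \<le> b"
    and b_le: "b \<le> n"
    and no_clique: "K (p + 2) = {}"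
begin

lemma card_N_insert: "x \<in> V \<Longrightarrow> card (N T) \<le> card (N (insert x T)) + b"
proof -
  assume x: "x \<in> V"
  have "card (N T) \<le> card (N (insert x T) \<union> nonN x)"
    by (rule card_mono) (auto simp: common_nbrs_def non_nbrs_def)
  also have "\<dots> \<le> card (N (insert x T)) + card (nonN x)" by (rule card_Un_le)
  finally show ?thesis using card_nonN_le[OF x] by simp
qed

lemma card_N_lower: 
  assumes "T \<in> K t" shows "n \<le> card (N T) + t * b"
proof -
  have "finite T" "T \<subseteq> V" using assms finite_in_cliques[OF assms] by (auto simp: cliques_def)
  then have "n \<le> card (N T) + card T * b"
  proof (induction T rule: finite_induct)
    case empty
    have "N {} = V" by (auto simp: common_nbrs_def)
    then show ?case by (simp add: card_V)
  next
    case (insert x T)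
    then show ?case using card_N_insert[of x T] by simp
  qed
  then show ?thesis using assms by (simp add: cliques_def)
qed

text \<open>Induction on \<open>q\<close>: a common neighbour of a (p+1)-clique would complete a
  (p+2)-clique, and extending \<open>T\<close> by a common neighbour shrinks \<open>N T\<close> by
  at most \<open>b\<close>.\<close>

lemma card_N_upper:
  "T \<in> K t \<Longrightarrow> t + q = p + 1 \<Longrightarrow> card (N T) \<le> q * b"
proof (induction q arbitrary: T t)
  case 0
  then have "N T = {}" using insert_in_cliques[of T t] no_clique by auto
  then show ?case by simp
next
  case (Suc q)
  show ?case
  proof (cases "N T = {}")
    case False
    then obtain v where v: "v \<in> N T" by auto
    then have "v \<in> V" by (simp add: common_nbrs_def)
    with Suc.IH[OF insert_in_cliques[OF Suc.prems(1) v]] Suc.prems(2) card_N_insert[of v T]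
    show ?thesis by simp
  qed simp
qed

lemma degree_ge: "x \<in> V \<Longrightarrow> real n - real b \<le> real (degree V E x)"
  using card_nonN[of x] card_nonN_le[of x] card_V by linarith

text \<open>The product of the distances of |N T| from its lower and upper bound. Its sign bounds
  the square of |N T| by a linear function, and it is 0 exactly when |N T| equals one of the
  bounds.\<close>

definition slack :: "nat \<Rightarrow> 'a set \<Rightarrow> real" where
  "slack t T = (real (card (N T)) - (real n - real t * real b)) * ((real p + 1 - real t) * real b - real (card (N T)))"

lemma slack_nonneg:
  assumes "T \<in> K t" "t \<le> p + 1" shows "0 \<le> slack t T"
proof -
  have "n \<le> card (N T) + t * b" "card (N T) \<le> (p + 1 - t) * b"
    using card_N_lower[OF assms(1)] card_N_upper[OF assms(1), of "p + 1 - t"] assms(2) by auto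
  then have "real n \<le> real (card (N T) + t * b)" "real (card (N T)) \<le> real ((p + 1 - t) * b)"
    by (simp_all only: of_nat_le_iff)
  then have "real n \<le> real (card (N T)) + real t * real b"
     "real (card (N T)) \<le> (real p + 1 - real t) * real b"
     using assms(2) by (simp_all add: of_nat_diff add.commute)
  then show ?thesis unfolding slack_def by (intro mult_nonneg_nonneg) auto
qed

text \<open>The inequality of \<open>remove_weight\<close> summed over \<open>V\<close>, with all
  degrees at least n - b. Equality follows when the vertices of \<open>S\<close> have degree n - b
  and every vertex misses at most two elements of \<open>S\<close>.\<close>

lemma sum_N_remove_ge:
  assumes S: "S \<in> K (Suc t)" and t: "1 \<le> t"
  shows "2 * real n - real (Suc t) * real b + (real t - 1) * real (card (N S)) \<le> (\<Sum>x\<in>S. real (card (N (S - {x}))))"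
    and "\<lbrakk>\<And>x. x \<in> S \<Longrightarrow> degree V E x = n - b; \<And>v. v \<in> V \<Longrightarrow> t \<le> card {x\<in>S. E x v} + 1\<rbrakk> \<Longrightarrow>
      2 * real n - real (Suc t) * real b + (real t - 1) * real (card (N S)) = (\<Sum>x\<in>S. real (card (N (S - {x}))))"
proof -
  have SV: "S \<subseteq> V" and cS: "card S = Suc t" using S by (auto simp: cliques_def)
  have "(\<Sum>x\<in>S. real n - real b) \<le> (\<Sum>x\<in>S. real (degree V E x))"
    using SV degree_ge by (intro sum_mono) auto
  then show "2 * real n - real (Suc t) * real b + (real t - 1) * real (card (N S)) \<le> (\<Sum>x\<in>S. real (card (N (S - {x}))))"
    using sum_remove_weight[OF S] sum_mono[OF remove_weight(1)[OF S t], of V "\<lambda>x. x"]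
    by (simp add: cS card_V algebra_simps)
  assume deg: "\<And>x. x \<in> S \<Longrightarrow> degree V E x = n - b" and adj: "\<And>v. v \<in> V \<Longrightarrow> t \<le> card {x\<in>S. E x v} + 1"
  have "(\<Sum>x\<in>S. real (degree V E x)) = (\<Sum>x\<in>S. real n - real b)"
    using deg b_le by (intro sum.cong) auto
  moreover have "(\<Sum>v\<in>V. real (card {x\<in>S. E x v}) - (real t - 1) + (real t - 1) * of_bool (v \<in> N S))
    = (\<Sum>v\<in>V. real (card {x\<in>S. v \<in> N (S - {x})}))"
    by (rule sum.cong[OF refl]) (rule remove_weight(2)[OF S t], auto dest: adj)
  ultimately show "2 * real n - real (Suc t) * real b + (real t - 1) * real (card (N S)) = (\<Sum>x\<in>S. real (card (N (S - {x}))))"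
    using sum_remove_weight[OF S] by (simp add: cS card_V algebra_simps)
qed

text \<open>The excess in the linear inequality between the clique numbers of orders t, t + 1, t + 2.\<close>
definition gap :: "nat \<Rightarrow> real" where
  "gap t = (real t - 1) * real n * real (kr V E (t + 1)) + (real p + 2 - 2 * real t) * (real t + 1) * real b * real (kr V E (t + 1))
    - (real n - real t * real b) * (real p + 1 - real t) * real b * real (kr V E t)
    - (real t - 1) * (real t + 2) * real (kr V E (t + 2))"

text \<open>The squares of |N T| enter the slack sum with a minus sign and, through
  \<open>sum_cliques_remove\<close>, the second sum with a plus sign. They cancel, so only clique
  numbers remain.\<close>

lemma gap_eq:
  "gap t = (\<Sum>T\<in>K t. slack t T)
     + (\<Sum>S\<in>K (Suc t). (\<Sum>x\<in>S. real (card (N (S - {x})))) - (2 * real n - real (Suc t) * real b + (real t - 1) * real (card (N S))))"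
proof -
  have "(\<Sum>T\<in>K t. slack t T) = (\<Sum>T\<in>K t. (real n + (real p + 1 - 2 * real t) * real b) * real (card (N T))
     - (real n - real t * real b) * (real p + 1 - real t) * real b - real (card (N T)) * real (card (N T)))"
    by (rule sum.cong) (auto simp: slack_def algebra_simps)
  also have "\<dots> = (real n + (real p + 1 - 2 * real t) * real b) * (real (Suc t) * real (kr V E (Suc t)))
     - (real n - real t * real b) * (real p + 1 - real t) * real b * real (kr V E t)
     - (\<Sum>T\<in>K t. real (card (N T)) * real (card (N T)))"
    by (simp add: sum_subtractf sum_distrib_left[symmetric] sum_card_common_nbrs kr_eq_card_cliques)
  finally have A: "(\<Sum>T\<in>K t. slack t T) = \<dots>" .
  have "(\<Sum>S\<in>K (Suc t). (\<Sum>x\<in>S. real (card (N (S - {x})))) - (2 * real n - real (Suc t) * real b + (real t - 1) * real (card (N S))))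
    = (\<Sum>T\<in>K t. real (card (N T)) * real (card (N T))) - (2 * real n - real (Suc t) * real b) * real (kr V E (Suc t))
      - (real t - 1) * (real (Suc (Suc t)) * real (kr V E (Suc (Suc t))))"
    by (simp only: sum_subtractf sum.distrib sum_distrib_left[symmetric] sum_card_common_nbrs
       sum_cliques_remove[of "\<lambda>T. real (card (N T))"] sum_constant kr_eq_card_cliques[symmetric]) (simp add: algebra_simps)
  then show ?thesis unfolding A gap_def by (simp add: algebra_simps)
qed

lemma gap_nonneg:
  assumes "1 \<le> t" "t \<le> p"
  shows "0 \<le> gap t"
  unfolding gap_eq using sum_N_remove_ge(1)[OF _ assms(1)] slack_nonneg[of _ t] assms
  by (intro add_nonneg_nonneg sum_nonneg) auto

lemma slack_eq_0_if_gap_eq_0: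
  assumes "1 \<le> t" "t \<le> p" "gap t = 0" "T \<in> K t"
  shows "slack t T = 0"
proof -
  have "0 \<le> (\<Sum>S\<in>K (Suc t). (\<Sum>x\<in>S. real (card (N (S - {x})))) - (2 * real n - real (Suc t) * real b + (real t - 1) * real (card (N S))))"
    using sum_N_remove_ge(1)[OF _ assms(1)] by (intro sum_nonneg) auto
  moreover have "0 \<le> (\<Sum>T\<in>K t. slack t T)" using slack_nonneg[of _ t] assms(2) by (intro sum_nonneg) auto
  ultimately have "(\<Sum>T\<in>K t. slack t T) = 0" using assms(3) gap_eq[of t] by linarith
  then show ?thesis using slack_nonneg[of _ t] assms by (subst (asm) sum_nonneg_eq_0_iff) auto
qed

end

section \<open>Structure of the graphs that attain equality\<close>

section \<open>Extremal partitions\<close>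

text \<open>The partition required by the family, without the condition on triangles and with
  b in place of \<open>\<beta> n\<close>.\<close>
definition extremal_partition ::
  "'a set \<Rightarrow> ('a \<Rightarrow> 'a \<Rightarrow> bool) \<Rightarrow> nat \<Rightarrow> nat \<Rightarrow> nat \<Rightarrow> (nat \<Rightarrow> 'a set) \<Rightarrow> bool" where
  "extremal_partition V E n b p P \<longleftrightarrow>
     V = (\<Union>i<p. P i) \<and>
     (\<forall>i<p. \<forall>j<p. i \<noteq> j \<longrightarrow> P i \<inter> P j = {}) \<and>
     card (P 0) + (p - 1) * b = n \<and>
     (\<forall>i. 1 \<le> i \<and> i < p \<longrightarrow> card (P i) = b) \<and>
     (\<forall>i j. i < j \<and> j < p \<longrightarrow> (\<forall>x\<in>P i. \<forall>y\<in>P j. E x y)) \<and>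
     (\<forall>i. 1 \<le> i \<and> i < p \<longrightarrow> (\<forall>x\<in>P i. \<forall>y\<in>P i. \<not> E x y)) \<and>
     (\<forall>v\<in>P 0. degree (P 0) E v + p * b = n)"

context clique_free_graph begin

lemma not_in_cliques: "T \<notin> K (p + 2)"
  using no_clique by simp

lemma card_nonN_regular:
  assumes "x \<in> V" "degree V E x = n - b"
  shows "card (nonN x) = b"
  using card_nonN[OF assms(1)] assms(2) card_V b_le by simp

text \<open>If n = (p + 1) * b the two admissible values n - p * b and b coincide, and every removal is full.\<close>
lemma many_full_removals:
  assumes p: "1 \<le> p" and tight: "\<And>T. T \<in> K p \<Longrightarrow> slack p T = 0"
    and S: "S \<in> K (p + 1)" and n_le: "n \<le> (p + 1) * b"
  shows "p - 1 \<le> card {x\<in>S. card (N (S - {x})) = b}"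
proof -
  define A where "A = {x\<in>S. card (N (S - {x})) = b}"
  define e where "e = (real p + 1) * real b - real n"
  have S': "S \<in> K (Suc p)" and fin: "finite S" and cS: "card S = Suc p"
    using S finite_in_cliques[OF S] by (auto simp: cliques_def)
  \<comment> \<open>Zero slack leaves only the values n - pb and \<open>b\<close>; \<open>e\<close>
    is their difference, and \<open>A\<close> collects the vertices with value
    \<open>b\<close>.\<close>
  have D: "real (card (N (S - {x}))) = real n - real p * real b + e * of_bool (x \<in> A)" if x: "x \<in> S" for x
  proof (cases "x \<in> A")
    case True
    then show ?thesis by (simp add: A_def e_def algebra_simps)
  next
    case False
    then have "real (card (N (S - {x}))) \<noteq> real b" using x by (simp add: A_def)
    then show ?thesis
      using tight[OF remove_in_cliques[OF S' x]] False by (simp add: slack_def)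
  qed
  have "(\<Sum>x\<in>S. of_bool (x \<in> A)) = real (card A)"
    using fin by (simp add: sum_of_bool_eq A_def Int_def conj_commute)
  then have sum: "(\<Sum>x\<in>S. real (card (N (S - {x})))) = (real p + 1) * (real n - real p * real b) + e * real (card A)"
    using D by (simp add: sum.distrib sum_distrib_left[symmetric] cS add.commute)
  have "0 \<le> (real p - 1) * real (card (N S))" using p by simp
  then have "2 * real n - (real p + 1) * real b \<le> (real p + 1) * (real n - real p * real b) + e * real (card A)"
    using sum_N_remove_ge(1)[OF S' p] unfolding sum by (simp add: add.commute)
  \<comment> \<open>After the nonnegative term with \<open>N S\<close> is dropped, the remaining
    terms of the left side exceed (p+1)(n - pb) by exactly (p-1)e.\<close>
  then have "e * (real p - 1 - real (card A)) \<le> 0"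
    unfolding e_def by (simp add: algebra_simps)
  moreover have "0 \<le> e"
  proof -
    have "real n \<le> real ((p + 1) * b)" using n_le by (simp only: of_nat_le_iff)
    then show ?thesis by (simp add: e_def algebra_simps)
  qed
  ultimately consider "e = 0" | "real p - 1 \<le> real (card A)"
    by (cases "e = 0") (auto simp: mult_le_0_iff)
  then show ?thesis
  proof cases
    case 1
    then have "real (card (N (S - {x}))) = real b" if "x \<in> S" for x
      using D[OF that] unfolding e_def by (simp add: algebra_simps)
    then have "A = S" unfolding A_def by auto
    then show ?thesis using cS by (simp add: A_def)
  next
    case 2
    then show ?thesis unfolding A_def by linarith
  qed
qed

text \<open>Choose p - 1 vertices x of \<open>S\<close> for which N(S - x) has size
  \<open>b\<close>. These neighbourhoods are the independent parts, and the rest of \<open>V\<close>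
  is \<open>P 0\<close>.\<close>

lemma extremal_partition_exists:
  assumes p: "1 \<le> p" and reg: "\<And>v. v \<in> V \<Longrightarrow> degree V E v = n - b"
    and tight: "\<And>T. T \<in> K p \<Longrightarrow> slack p T = 0"
    and S: "S \<in> K (p + 1)" and n_le: "n \<le> (p + 1) * b"
  shows "\<exists>P. extremal_partition V E n b p P \<and> cliques (P 0) E 3 = {}"
proof -
  obtain A where A: "A \<subseteq> {x\<in>S. card (N (S - {x})) = b}" "card A = p - 1" "finite A"
    by (rule obtain_subset_with_card_n[OF many_full_removals[OF p tight S n_le]])
  define Q where "Q x = N (S - {x})" for x
  have S': "S \<in> K (Suc p)" using S by simp
  have AS: "A \<subseteq> S" and cQ: "x \<in> A \<Longrightarrow> card (Q x) = b" for x using A(1) by (auto simp: Q_def)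
  have xQ: "x \<in> Q x" if "x \<in> A" for x
    unfolding Q_def using in_common_nbrs_remove[OF S'] that AS by auto
  have QV: "Q x \<subseteq> V" for x by (auto simp: Q_def common_nbrs_def)
  \<comment> \<open>Two adjacent vertices of \<open>Q x\<close> would extend \<open>S - {x}\<close>
    to a (p+2)-clique.\<close>
  have indep: "\<not> E u v" if "x \<in> A" "u \<in> Q x" "v \<in> Q x" for x u v
  proof
    assume uv: "E u v"
    have "S - {x} \<in> K p" using remove_in_cliques[OF S'] that AS by auto
    then have "insert u (S - {x}) \<in> K (Suc p)" using insert_in_cliques that(2) by (simp add: Q_def)
    moreover have "v \<in> N (insert u (S - {x}))" using that(3) uv by (auto simp: Q_def common_nbrs_def)
    ultimately have "insert v (insert u (S - {x})) \<in> K (Suc (Suc p))" by (rule insert_in_cliques)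
    then show False using not_in_cliques by simp
  qed
  \<comment> \<open>By independence \<open>Q x\<close> consists of non-neighbours of
    \<open>v\<close>, and both sets have size \<open>b\<close>. So \<open>v\<close> is adjacent to
    everything outside its part.\<close>
  have nonN: "nonN v = Q x" if "x \<in> A" "v \<in> Q x" for x v
  proof (rule card_subset_eq[symmetric])
    show "Q x \<subseteq> nonN v" using indep[OF that] QV by (auto simp: non_nbrs_def)
    show "card (Q x) = card (nonN v)"
      using card_nonN_regular[of v] reg[of v] that QV cQ by auto
  qed simp
  \<comment> \<open>A vertex of both sets is adjacent to \<open>S - {x}\<close> and to
    \<open>S - {y}\<close>, hence to all of \<open>S\<close>, which again gives a
    (p+2)-clique.\<close>
  have disj: "Q x \<inter> Q y = {}" if "x \<in> A" "y \<in> A" "x \<noteq> y" for x y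
  proof (rule ccontr)
    assume "Q x \<inter> Q y \<noteq> {}"
    then obtain v where "v \<in> Q x" "v \<in> Q y" by auto
    then have "v \<in> N S" using that by (auto simp: Q_def common_nbrs_def)
    then show False using insert_in_cliques[OF S'] not_in_cliques by auto
  qed
  have "card {1..<p} = card A" using A(2) by simp
  then obtain h where h: "bij_betw h {1..<p} A"
    using A(3) by (metis finite_atLeastLessThan finite_same_card_bij)
  define P where "P i = (if i = 0 then V - (\<Union>x\<in>A. Q x) else Q (h i))" for i :: nat
  have hA: "h i \<in> A" if "1 \<le> i" "i < p" for i using h that by (auto simp: bij_betw_def)
  have h_inj: "h i \<noteq> h j" if "1 \<le> i" "i < p" "1 \<le> j" "j < p" "i \<noteq> j" for i j
    using h that by (auto simp: bij_betw_def inj_on_def)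
  have UN: "(\<Union>x\<in>A. Q x) = (\<Union>i\<in>{1..<p}. P i)"
    using h by (auto simp: bij_betw_def P_def)
  have P0: "P 0 = V - (\<Union>x\<in>A. Q x)" by (simp add: P_def)
  have adj0: "E u v" "E v u" if "u \<in> P 0" "x \<in> A" "v \<in> Q x" for u x v
  proof -
    have "u \<notin> nonN v" "u \<in> V" using that nonN[OF that(2,3)] by (auto simp: P0)
    then show "E v u" by (simp add: non_nbrs_def)
    then show "E u v" by (rule E_sym)
  qed
  have card0: "card (P 0) + (p - 1) * b = n"
  proof -
    have "card (\<Union>x\<in>A. Q x) = (\<Sum>x\<in>A. card (Q x))"
      by (rule card_UN_disjoint) (use A(3) disj in \<open>auto simp: Q_def\<close>)
    also have "\<dots> = (p - 1) * b" using cQ A(2) by simp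
    finally have c: "card (\<Union>x\<in>A. Q x) = (p - 1) * b" .
    moreover have "(\<Union>x\<in>A. Q x) \<subseteq> V" using QV by auto
    ultimately show ?thesis
      unfolding P0 using card_Diff_subset[of "\<Union>x\<in>A. Q x" V] card_mono[of V "\<Union>x\<in>A. Q x"] card_V
      by (auto dest: finite_subset)
  qed
  have "extremal_partition V E n b p P"
    unfolding extremal_partition_def
  proof (intro conjI allI impI ballI)
    have "{..<p} = insert 0 {1..<p}" using p by auto
    then have "(\<Union>i<p. P i) = P 0 \<union> (\<Union>i\<in>{1..<p}. P i)" by simp
    also have "\<dots> = V" unfolding UN[symmetric] P0 using QV by auto
    finally show "V = (\<Union>i<p. P i)" ..
  next
    fix i j assume ij: "i < p" "j < p" "i \<noteq> j"
    have 0: "P 0 \<inter> P k = {}" if "k \<noteq> 0" "k < p" for k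
      using that hA[of k] by (auto simp: P_def)
    show "P i \<inter> P j = {}"
    proof (cases "i = 0 \<or> j = 0")
      case True
      then show ?thesis using 0[of i] 0[of j] ij by (auto simp: Int_commute)
    next
      case False
      then show ?thesis using disj[OF hA hA h_inj, of i j] ij by (auto simp: P_def Suc_le_eq)
    qed
  next
    fix i assume "1 \<le> i \<and> i < p"
    then show "card (P i) = b" using cQ[OF hA] by (simp add: P_def)
  next
    fix i j x y assume ij: "i < j \<and> j < p" and x: "x \<in> P i" and y: "y \<in> P j"
    then have y': "y \<in> Q (h j)" and j: "h j \<in> A" using hA[of j] by (auto simp: P_def)
    show "E x y"
    proof (cases "i = 0")
      case True
      then show ?thesis using adj0(1)[OF _ j y'] x by simp
    next
      case False
      then have x': "x \<in> Q (h i)" and i: "h i \<in> A" using x hA[of i] ij by (auto simp: P_def)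
      have "h i \<noteq> h j" using h_inj[of i j] ij False by auto
      then have "y \<notin> nonN x" using disj[OF i j] nonN[OF i x'] y' by auto
      then show ?thesis using y' QV by (auto simp: non_nbrs_def)
    qed
  next
    fix i x y assume "1 \<le> i \<and> i < p" "x \<in> P i" "y \<in> P i"
    then show "\<not> E x y" using indep[OF hA, of i x y] by (simp add: P_def)
  next
    show "card (P 0) + (p - 1) * b = n" by (rule card0)
  next
    fix v assume v: "v \<in> P 0"
    then have vV: "v \<in> V" by (simp add: P0)
    \<comment> \<open>All \<open>b\<close> non-neighbours of \<open>v\<close> lie in
      \<open>P 0\<close>, so its degree there is |P 0| - b = n - pb.\<close>
    have "nonN v \<subseteq> P 0" using adj0(1)[OF v] by (auto simp: P0 non_nbrs_def)
    moreover have "P 0 \<subseteq> V" by (simp add: P0)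
    ultimately have "P 0 = {u\<in>P 0. E v u} \<union> nonN v" by (auto simp: non_nbrs_def)
    moreover have "card ({u\<in>P 0. E v u} \<union> nonN v) = degree (P 0) E v + card (nonN v)"
      unfolding degree_def by (rule card_Un_disjoint) (auto simp: non_nbrs_def P0)
    ultimately have "card (P 0) = degree (P 0) E v + b"
      using card_nonN_regular[OF vV reg[OF vV]] by simp
    then show "degree (P 0) E v + p * b = n" using card0 p by (cases p) auto
  qed
  \<comment> \<open>A triangle in \<open>P 0\<close> together with the p - 1 pairwise adjacent
    vertices of \<open>A\<close>, which lie in the other parts, would be a (p+2)-clique.\<close>
  moreover have "cliques (P 0) E 3 = {}"
  proof (rule ccontr)
    assume "cliques (P 0) E 3 \<noteq> {}"
    then obtain R where R: "R \<subseteq> P 0" "card R = 3" "clique E R" by (auto simp: cliques_def)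
    have "clique E A" using S AS by (auto simp: cliques_def clique_def)
    then have "clique E (R \<union> A)"
      using R adj0[OF _ _ xQ] unfolding clique_def by blast
    moreover have "R \<inter> A = {}" using R(1) xQ by (auto simp: P0)
    then have "card (R \<union> A) = p + 2"
      using R(2) A(2,3) p by (subst card_Un_disjoint) (auto intro: card_ge_0_finite)
    moreover have "R \<union> A \<subseteq> V" using R(1) xQ QV by (auto simp: P0)
    ultimately show False using no_clique by (auto simp: cliques_def)
  qed
  ultimately show ?thesis by blast
qed

text \<open>Every estimate behind \<open>gap_nonneg\<close> is sharp here: the graph is regular, a
  clique has at most two vertices in \<open>P 0\<close> and at most one in each other part, and
  non-neighbours of a vertex share its part.\<close>

lemma gap_eq_0_if_extremal_partition:
  assumes P: "extremal_partition V E n b p P" and tf: "cliques (P 0) E 3 = {}" 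
    and t: "1 \<le> t" "t \<le> p"
  shows "gap t = 0"
proof -
  have V: "V = (\<Union>i<p. P i)" and disj: "\<And>i j. i < p \<Longrightarrow> j < p \<Longrightarrow> i \<noteq> j \<Longrightarrow> P i \<inter> P j = {}"
    and card0: "card (P 0) + (p - 1) * b = n"
    and cardP: "\<And>i. 1 \<le> i \<Longrightarrow> i < p \<Longrightarrow> card (P i) = b"
    and compl: "\<And>i j x y. i < j \<Longrightarrow> j < p \<Longrightarrow> x \<in> P i \<Longrightarrow> y \<in> P j \<Longrightarrow> E x y"
    and indep: "\<And>i x y. 1 \<le> i \<Longrightarrow> i < p \<Longrightarrow> x \<in> P i \<Longrightarrow> y \<in> P i \<Longrightarrow> \<not> E x y"
    and deg0: "\<And>v. v \<in> P 0 \<Longrightarrow> degree (P 0) E v + p * b = n"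
    using P unfolding extremal_partition_def by blast+
  have p: "1 \<le> p" using t by simp
  have PV: "P i \<subseteq> V" if "i < p" for i using that V by auto
  have finP: "finite (P i)" if "i < p" for i using PV[OF that] by (rule finite_subset) simp
  have compl': "E x y" if "i < p" "j < p" "i \<noteq> j" "x \<in> P i" "y \<in> P j" for i j x y
    using that compl[of i j x y] E_sym[OF compl[of j i y x]] by (cases "i < j") auto
  have nonN_sub: "nonN x \<subseteq> P i" if "i < p" "x \<in> P i" for i x
    using that compl' V by (auto simp: non_nbrs_def) 
  have part: "\<exists>i<p. x \<in> P i" if "x \<in> V" for x using that V by auto
  have cN: "card (nonN x) = b" if "x \<in> V" for x
  proof -
    obtain i where i: "i < p" "x \<in> P i" using part[OF \<open>x \<in> V\<close>] by auto
    show ?thesis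
    proof (cases "i = 0")
      case True
      have "P 0 = {u\<in>P 0. E x u} \<union> nonN x"
        using nonN_sub[OF i] True PV[of 0] p by (auto simp: non_nbrs_def)
      moreover have "card ({u\<in>P 0. E x u} \<union> nonN x) = degree (P 0) E x + card (nonN x)"
        unfolding degree_def by (rule card_Un_disjoint) (use finP[of 0] p in \<open>auto simp: non_nbrs_def\<close>)
      ultimately have "card (P 0) = degree (P 0) E x + card (nonN x)" by simp
      moreover have "p * b = (p - 1) * b + b" using p by (cases p) auto
      ultimately show ?thesis using card0 deg0[of x] i True by simp
    next
      case False
      then have "nonN x = P i" using nonN_sub[OF i] indep[of i x] i PV[OF i(1)] by (auto simp: non_nbrs_def)
      then show ?thesis using cardP[of i] False i by simp
    qed
  qed
  have reg: "degree V E x = n - b" if "x \<in> V" for x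
    using card_nonN[OF that] cN[OF that] card_V by simp
  have le1: "x = y" if "S \<in> K s" "x \<in> S" "y \<in> S" "x \<in> P i" "y \<in> P i" "1 \<le> i" "i < p" for S s x y i
    using that indep[of i x y] by (auto simp: cliques_def clique_def)
  have le2: "card (S \<inter> P 0) \<le> 2" if S: "S \<in> K s" for S s
  proof (rule ccontr)
    assume "\<not> card (S \<inter> P 0) \<le> 2"
    then have "3 \<le> card (S \<inter> P 0)" by simp
    then obtain R where "R \<subseteq> S \<inter> P 0" "card R = 3" by (metis obtain_subset_with_card_n)
    moreover from this S have "clique E R" using clique_mono[of E S R] by (auto simp: cliques_def)
    ultimately show False using tf by (auto simp: cliques_def)
  qed
  have adj: "s \<le> card {x\<in>S. E x v} + 1" if S: "S \<in> K (Suc s)" and v: "v \<in> V" for S s v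
  proof -
    have fin: "finite S" and cS: "card S = Suc s" using S finite_in_cliques[OF S] by (auto simp: cliques_def)
    obtain i where i: "i < p" "v \<in> P i" using part[OF v] by auto
    have "{x\<in>S. \<not> E x v} \<subseteq> S \<inter> nonN v"
      using S E_sym[of v] by (auto simp: non_nbrs_def cliques_def)
    then have sub: "{x\<in>S. \<not> E x v} \<subseteq> S \<inter> P i" using nonN_sub[OF i] by auto
    have "card (S \<inter> P i) \<le> 2"
    proof (cases "i = 0")
      case False
      then have "card (S \<inter> P i) \<le> 1"
        using le1[OF S, of _ _ i] i fin by (subst One_nat_def, subst card_le_Suc0_iff_eq) auto
      then show ?thesis by simp
    qed (use le2[OF S] in simp)
    then have "card {x\<in>S. \<not> E x v} \<le> 2" using card_mono[OF _ sub] fin by simp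
    moreover have "S = {x\<in>S. E x v} \<union> {x\<in>S. \<not> E x v}" by auto
    then have "card S \<le> card {x\<in>S. E x v} + card {x\<in>S. \<not> E x v}" by (metis card_Un_le)
    ultimately show ?thesis using cS by simp
  qed
  \<comment> \<open>Two vertices of a clique share a part only in \<open>P 0\<close>; otherwise
    their non-neighbourhoods lie in different parts.\<close>
  have nonN_disj: "nonN x \<inter> nonN y = {}"
    if "T \<in> K t" "x \<in> T" "y \<in> T" "x \<noteq> y" "\<not> (x \<in> P 0 \<and> y \<in> P 0)" for T x y
  proof -
    have "x \<in> V" "y \<in> V" using that by (auto simp: cliques_def)
    then obtain i j where ij: "i < p" "x \<in> P i" "j < p" "y \<in> P j" using part by metis
    have "i \<noteq> j"
    proof
      assume "i = j"
      then show False using le1[OF that(1-3), of i] ij that(4,5) by (cases "i = 0") auto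
    qed
    then show ?thesis using nonN_sub[OF ij(1,2)] nonN_sub[OF ij(3,4)] disj[of i j] ij by blast
  qed
  have slack0: "slack t T = 0" if T: "T \<in> K t" for T
  proof -
    have fin: "finite T" and cT: "card T = t" and TV: "T \<subseteq> V"
      using T finite_in_cliques[OF T] by (auto simp: cliques_def)
    have "V = N T \<union> (\<Union>x\<in>T. nonN x)" by (auto simp: common_nbrs_def non_nbrs_def)
    moreover have "card (N T \<union> (\<Union>x\<in>T. nonN x)) = card (N T) + card (\<Union>x\<in>T. nonN x)"
      by (rule card_Un_disjoint) (use fin in \<open>auto simp: common_nbrs_def non_nbrs_def\<close>)
    ultimately have tot: "card (N T) + card (\<Union>x\<in>T. nonN x) = n" using card_V by simp
    have card_UN: "card (\<Union>x\<in>U. nonN x) = card U * b"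
      if U: "U \<subseteq> T" "\<And>x y. x \<in> U \<Longrightarrow> y \<in> U \<Longrightarrow> x \<noteq> y \<Longrightarrow> \<not> (x \<in> P 0 \<and> y \<in> P 0)" for U
    proof -
      have "card (\<Union>x\<in>U. nonN x) = (\<Sum>x\<in>U. card (nonN x))"
        using nonN_disj[OF T] U finite_subset[OF U(1) fin] by (intro card_UN_disjoint) (auto simp: subset_iff)
      also have "\<dots> = (\<Sum>x\<in>U. b)" using U(1) TV cN by (intro sum.cong) auto
      finally show ?thesis by simp
    qed
    show ?thesis
    proof (cases "card (T \<inter> P 0) \<le> 1")
      case True
      then have "\<forall>x\<in>T \<inter> P 0. \<forall>y\<in>T \<inter> P 0. x = y"
        using fin card_le_Suc0_iff_eq[of "T \<inter> P 0"] by simp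
      then have "\<not> (x \<in> P 0 \<and> y \<in> P 0)" if "x \<in> T" "y \<in> T" "x \<noteq> y" for x y
        using that by blast
      \<comment> \<open>With at most one vertex in \<open>P 0\<close>, the non-neighbourhoods are
        pairwise disjoint and |N T| is the lower bound n - tb.\<close>
      then have "card (\<Union>x\<in>T. nonN x) = t * b" using card_UN[OF subset_refl] cT by blast
      then have "real (card (N T)) = real n - real t * real b"
        unfolding tot[symmetric] by simp
      then show ?thesis by (simp add: slack_def)
    next
      case False
      then have c2: "card (T \<inter> P 0) = 2" using le2[OF T] by simp
      then obtain x y where xy: "T \<inter> P 0 = {x, y}" "x \<noteq> y" by (auto simp: card_2_iff)
      then have Exy: "E x y" and xyT: "x \<in> T" "y \<in> T" "x \<in> P 0" "y \<in> P 0"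
        using T by (auto simp: cliques_def clique_def)
      \<comment> \<open>Adjacent \<open>x\<close> and \<open>y\<close> have no common neighbour in
        the triangle-free \<open>P 0\<close>. Hence \<open>T\<close> excludes all of
        \<open>P 0\<close> and t - 2 further sets of size \<open>b\<close>, and |N T| is the upper
        bound (p+1-t)b.\<close>
      have "P 0 \<subseteq> nonN x \<union> nonN y"
      proof
        fix u assume u: "u \<in> P 0"
        show "u \<in> nonN x \<union> nonN y"
        proof (rule ccontr)
          assume "u \<notin> nonN x \<union> nonN y"
          then have xu: "E x u" "E y u" using u PV[of 0] p by (auto simp: non_nbrs_def)
          then have "clique E {x, y, u}" "u \<noteq> x" "u \<noteq> y"
            using Exy E_sym[OF Exy] E_sym[OF xu(1)] E_sym[OF xu(2)] by (auto simp: clique_def)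
          then have "{x, y, u} \<in> cliques (P 0) E 3" using xyT u xy(2) by (auto simp: cliques_def)
          then show False using tf by simp
        qed
      qed
      then have P0: "nonN x \<union> nonN y = P 0" using nonN_sub[of 0] xyT p by auto
      have Teq: "T = {x, y} \<union> (T - P 0)" using xy by auto
      have UN: "(\<Union>z\<in>T. nonN z) = P 0 \<union> (\<Union>z\<in>T - P 0. nonN z)"
        using arg_cong[OF Teq, of "\<lambda>U. \<Union>z\<in>U. nonN z"]
        unfolding UN_Un UN_insert UN_empty Un_empty_right P0 .
      have "card (P 0 \<union> (\<Union>z\<in>T - P 0. nonN z)) = card (P 0) + card (\<Union>z\<in>T - P 0. nonN z)"
      proof (rule card_Un_disjoint)
        have "(nonN x \<union> nonN y) \<inter> nonN z = {}" if "z \<in> T - P 0" for z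
          using nonN_disj[OF T xyT(1), of z] nonN_disj[OF T xyT(2), of z] that xyT(3,4) by auto
        then show "P 0 \<inter> (\<Union>z\<in>T - P 0. nonN z) = {}" unfolding P0 by blast
      qed (use finP[of 0] p fin in auto)
      moreover have "card (\<Union>z\<in>T - P 0. nonN z) = card (T - P 0) * b" by (rule card_UN) auto
      moreover have "card (T - P 0) + 2 = t"
        using card_Diff_subset_Int[of T "P 0"] c2 cT fin card_mono[of T "T \<inter> P 0"] by simp
      ultimately have "card (N T) + card (T - P 0) * b = (p - 1) * b" "card (T - P 0) + 2 = t"
        using tot[unfolded UN] card0 by linarith+
      then have "real (card (N T)) + real (card (T - P 0)) * real b = real (p - 1) * real b"
         "real (card (T - P 0)) = real t - 2"
        unfolding of_nat_mult[symmetric] of_nat_add[symmetric] by (simp, linarith)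
      then have "real (card (N T)) = (real p + 1 - real t) * real b"
        using p by (simp add: algebra_simps of_nat_diff)
      then show ?thesis by (simp add: slack_def)
    qed
  qed
  have "(\<Sum>x\<in>S. real (card (N (S - {x})))) - (2 * real n - real (Suc t) * real b + (real t - 1) * real (card (N S))) = 0"
    if S: "S \<in> K (Suc t)" for S
  proof -
    have "S \<subseteq> V" using S by (simp add: cliques_def)
    then show ?thesis
      using sum_N_remove_ge(2)[OF S t(1) reg adj[OF S]] by (simp add: subset_iff)
  qed
  then show ?thesis unfolding gap_eq using slack0 by simp
qed

end

section \<open>Relabelling vertices along bijections\<close>

section \<open>Transport along bijections\<close>

lemma card_bij_cong:
  assumes "bij_betw f A B" "\<And>x. x \<in> A \<Longrightarrow> P x \<longleftrightarrow> Q (f x)"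
  shows "card {x\<in>A. P x} = card {y\<in>B. Q y}"
proof (rule bij_betw_same_card)
  show "bij_betw f {x\<in>A. P x} {y\<in>B. Q y}"
    using assms unfolding bij_betw_def inj_on_def by auto
qed

lemma degree_bij_cong:
  assumes "bij_betw f A B" "\<And>x y. x \<in> A \<Longrightarrow> y \<in> A \<Longrightarrow> E' x y \<longleftrightarrow> E (f x) (f y)" "v \<in> A"
  shows "degree A E' v = degree B E (f v)"
  unfolding degree_def using assms by (intro card_bij_cong[of f]) auto

lemma kr_bij_cong:
  assumes f: "bij_betw f A B" and E: "\<And>x y. x \<in> A \<Longrightarrow> y \<in> A \<Longrightarrow> E' x y \<longleftrightarrow> E (f x) (f y)"
  shows "kr A E' r = kr B E r"
proof -
  have inj: "inj_on f A" and "f ` A = B" using f by (auto simp: bij_betw_def)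
  have "card {S\<in>Pow A. card S = r \<and> clique E' S} = card {S\<in>Pow B. card S = r \<and> clique E S}"
  proof (rule card_bij_cong)
    show "bij_betw ((`) f) (Pow A) (Pow B)" by (rule bij_betw_Pow[OF f])
    fix S assume "S \<in> Pow A"
    then have SA: "S \<subseteq> A" by simp
    then have injS: "inj_on f S" using inj by (rule inj_on_subset[rotated])
    have "clique E' S \<longleftrightarrow> clique E (f ` S)"
      unfolding clique_def ball_simps using SA E injS by (auto simp: inj_on_eq_iff subset_iff)
    then show "card S = r \<and> clique E' S \<longleftrightarrow> card (f ` S) = r \<and> clique E (f ` S)"
      using card_image[OF injS] by simp
  qed
  then show ?thesis by (simp add: kr_def)
qed

text \<open>Membership in \<open>A\<close> is part of the relation because \<open>sgraph\<close>
  allows edges only between vertices. Such copies are needed since feasibility and the triangle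
  minimum range over graphs on initial segments of the naturals.\<close>

definition pullback :: "'b set \<Rightarrow> ('b \<Rightarrow> 'a) \<Rightarrow> ('a \<Rightarrow> 'a \<Rightarrow> bool) \<Rightarrow> 'b \<Rightarrow> 'b \<Rightarrow> bool" where
  "pullback A f E x y \<longleftrightarrow> x \<in> A \<and> y \<in> A \<and> E (f x) (f y)"

lemma sgraph_pullback: "finite A \<Longrightarrow> sgraph V E \<Longrightarrow> sgraph A (pullback A f E)"
  unfolding sgraph_def pullback_def by blast

lemma extremal_partition_pullback:
  assumes P: "extremal_partition V E n b p P" and p: "1 \<le> p" and f: "bij_betw f A V"
  shows "extremal_partition A (pullback A f E) n b p (\<lambda>i. {x\<in>A. f x \<in> P i})"
    and "bij_betw f {x\<in>A. f x \<in> P 0} (P 0)"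
proof -
  have V: "V = (\<Union>i<p. P i)" using P unfolding extremal_partition_def by blast
  have PV: "P i \<subseteq> V" if "i < p" for i using V that by auto
  have fA: "f ` A = V" "inj_on f A" using f by (auto simp: bij_betw_def)
  have bij: "bij_betw f {x\<in>A. f x \<in> P i} (P i)" if "i < p" for i
    using PV[OF that] fA unfolding bij_betw_def inj_on_def by auto
  have c: "card {x\<in>A. f x \<in> P i} = card (P i)" if "i < p" for i
    using bij[OF that] by (rule bij_betw_same_card)
  show bij0: "bij_betw f {x\<in>A. f x \<in> P 0} (P 0)" using bij p by simp
  have d: "degree {x\<in>A. f x \<in> P 0} (pullback A f E) v = degree (P 0) E (f v)" if "v \<in> A" "f v \<in> P 0" for v
    using that by (intro degree_bij_cong[OF bij0]) (auto simp: pullback_def)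
  show "extremal_partition A (pullback A f E) n b p (\<lambda>i. {x\<in>A. f x \<in> P i})"
    unfolding extremal_partition_def
  proof (intro conjI allI impI ballI)
    show "A = (\<Union>i<p. {x\<in>A. f x \<in> P i})" using fA V by auto
    show "card {x\<in>A. f x \<in> P 0} + (p - 1) * b = n"
      using c[of 0] p P unfolding extremal_partition_def by simp
  next
    fix i j assume "i < p" "j < p" "i \<noteq> j"
    then have "P i \<inter> P j = {}" using P unfolding extremal_partition_def by blast
    then show "{x\<in>A. f x \<in> P i} \<inter> {x\<in>A. f x \<in> P j} = {}" by blast
  next
    fix i assume "1 \<le> i \<and> i < p"
    then show "card {x\<in>A. f x \<in> P i} = b" using c[of i] P unfolding extremal_partition_def by simp
  next
    fix i j x y assume "i < j \<and> j < p" "x \<in> {x\<in>A. f x \<in> P i}" "y \<in> {x\<in>A. f x \<in> P j}"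
    then show "pullback A f E x y" using P unfolding extremal_partition_def pullback_def by blast
  next
    fix i x y assume "1 \<le> i \<and> i < p" "x \<in> {x\<in>A. f x \<in> P i}" "y \<in> {x\<in>A. f x \<in> P i}"
    then show "\<not> pullback A f E x y" using P unfolding extremal_partition_def pullback_def by blast
  next
    fix v assume "v \<in> {x\<in>A. f x \<in> P 0}"
    then show "degree {x\<in>A. f x \<in> P 0} (pullback A f E) v + p * b = n"
      using d[of v] P unfolding extremal_partition_def by simp
  qed
qed

lemma kr_eq_0_iff: "finite V \<Longrightarrow> kr V E r = 0 \<longleftrightarrow> cliques V E r = {}"
  unfolding kr_eq_card_cliques by (subst card_0_eq) (auto simp: cliques_def intro: finite_subset[of _ "Pow V"])

lemma finite_extremal_partition_0:
  "finite V \<Longrightarrow> 1 \<le> p \<Longrightarrow> extremal_partition V E n b p P \<Longrightarrow> finite (P 0)"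
  unfolding extremal_partition_def by (metis UN_upper finite_subset lessThan_iff less_le_trans zero_less_one)

section \<open>Monotonicity and rigidity of the normalized clique numbers\<close>

section \<open>Ratios of clique numbers\<close>

text \<open>The ceiling bounds for n/b, multiplied by \<open>b\<close>, become inequalities between
  natural numbers; \<open>p\<close> is positive because n/b > 1.\<close>

lemma pval_ratio:
  assumes "0 < b" "b < n"
  obtains p where "pval (real b / real n) = int p" "1 \<le> p" "p * b < n" "n \<le> (p + 1) * b"
proof
  define x where "x = real n / real b"
  define p where "p = nat (pval (real b / real n))"
  have x: "x > 1" "real n = x * real b" using assms by (auto simp: x_def)
  have pv: "pval (real b / real n) = \<lceil>x\<rceil> - 1" by (simp add: pval_def x_def)
  have "1 < \<lceil>x\<rceil>" using x(1) by (simp add: less_ceiling_iff)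
  then have ip: "int p = \<lceil>x\<rceil> - 1" and "1 \<le> p" unfolding p_def pv by linarith+
  then have p: "real p = of_int \<lceil>x\<rceil> - 1" "1 \<le> p" "pval (real b / real n) = int p"
    unfolding pv by linarith+
  show "pval (real b / real n) = int (nat (pval (real b / real n)))" "1 \<le> nat (pval (real b / real n))"
    using p unfolding p_def by auto
  have "real p < x" "x \<le> real p + 1" unfolding p(1) by linarith+
  then have "real p * real b < real n" "real n \<le> (real p + 1) * real b"
    unfolding x(2) using assms(1) by (auto intro: mult_strict_right_mono mult_right_mono)
  then have "real (p * b) < real n" "real n \<le> real ((p + 1) * b)" by (simp_all add: algebra_simps)
  then show "nat (pval (real b / real n)) * b < n" "n \<le> (nat (pval (real b / real n)) + 1) * b"
    unfolding p_def of_nat_le_iff of_nat_less_iff .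
qed

locale min_degree_graph = clique_free_graph +
  fixes \<beta> :: real
  assumes b_pos: "0 < b" and n_pos: "0 < n" and \<beta>: "\<beta> = real b / real n"
    and pval: "pval \<beta> = int p" and p_pos: "1 \<le> p" and pb_less: "p * b < n" and n_le: "n \<le> (p + 1) * b"
begin

lemma real_b: "real b = \<beta> * real n"
  using n_pos by (simp add: \<beta>)

lemma \<beta>_pos: "0 < \<beta>" and p\<beta>_less: "real p * \<beta> < 1"
proof -
  show "0 < \<beta>" using b_pos n_pos by (simp add: \<beta>)
  have "real (p * b) < real n" using pb_less by (simp only: of_nat_less_iff)
  then show "real p * \<beta> < 1" using n_pos by (simp add: \<beta>)
qed

text \<open>From index p + 2 on the denominator is 0, and so is the quotient by convention. The
  value at p + 2 enters the inequalities only with the factor \<open>w p\<close>, which is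
  0.\<close>

definition \<rho> :: "nat \<Rightarrow> real" where
  "\<rho> t = real (kr V E t) / (g t \<beta> * real n ^ t)"

text \<open>\<open>u\<close> and \<open>w\<close> are the two terms on the left of
  \<open>g_recurrence\<close>, so the term on its right is \<open>u t + w t\<close>.\<close>

definition u :: "nat \<Rightarrow> real" where
  "u t = (1 - real t * \<beta>) * (real p + 1 - real t) * \<beta> * g t \<beta>"

definition w :: "nat \<Rightarrow> real" where
  "w t = (real t - 1) * (real t + 2) * g (t + 2) \<beta>"

lemma g_gt_0: "1 \<le> t \<Longrightarrow> t \<le> p + 1 \<Longrightarrow> 0 < g t \<beta>"
  by (rule g_pos[OF pval p_pos \<beta>_pos p\<beta>_less])

lemma kr_eq_\<rho>: "1 \<le> t \<Longrightarrow> t \<le> p + 1 \<Longrightarrow> real (kr V E t) = \<rho> t * g t \<beta> * real n ^ t"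
  using g_gt_0[of t] n_pos by (simp add: \<rho>_def)

lemma kr_eq_iff_\<rho>: "1 \<le> t \<Longrightarrow> t \<le> p + 1 \<Longrightarrow> real (kr V E t) = g t \<beta> * real n ^ t \<longleftrightarrow> \<rho> t = 1"
  using g_gt_0[of t] n_pos by (auto simp: \<rho>_def)

lemma u_pos: 
  assumes "1 \<le> t" "t \<le> p" shows "0 < u t"
proof -
  have "real t * \<beta> \<le> real p * \<beta>" using assms \<beta>_pos by (intro mult_right_mono) auto
  then have "0 < 1 - real t * \<beta>" using p\<beta>_less by linarith
  then show ?thesis unfolding u_def using assms g_gt_0[of t] \<beta>_pos by simp
qed

lemma w_p: "w p = 0"
  unfolding w_def using g_eq_0[OF pval p_pos] by simp

lemma w_pos: "2 \<le> t \<Longrightarrow> t < p \<Longrightarrow> 0 < w t"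
  unfolding w_def using g_gt_0[of "t + 2"] by simp

lemma w_nonneg: "1 \<le> t \<Longrightarrow> t \<le> p \<Longrightarrow> 0 \<le> w t"
  using w_pos[of t] w_p by (cases "t = 1"; cases "t = p") (auto simp: w_def)

text \<open>Since the middle coefficient splits as \<open>u t + w t\<close>, the three-term
  expression becomes a difference of two weighted increments.\<close>

lemma gap_eq_\<rho>:
  assumes t: "1 \<le> t" "t \<le> p"
  shows "gap t = real n ^ (t + 2) * (u t * (\<rho> (t + 1) - \<rho> t) - w t * (\<rho> (t + 2) - \<rho> (t + 1)))"
proof -
  have k0: "real (kr V E t) = \<rho> t * g t \<beta> * real n ^ t"
    and k1: "real (kr V E (t + 1)) = \<rho> (t + 1) * g (t + 1) \<beta> * real n ^ (t + 1)"
    using kr_eq_\<rho>[of t] kr_eq_\<rho>[of "t + 1"] t by auto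
  \<comment> \<open>For \<open>t = p\<close> both sides are 0: there is no (p+2)-clique, and
    \<open>w p\<close> vanishes.\<close>
  have k2: "(real t - 1) * (real t + 2) * real (kr V E (t + 2)) = w t * \<rho> (t + 2) * real n ^ (t + 2)"
  proof (cases "t = p")
    case True
    then show ?thesis using no_clique w_p by (simp add: kr_eq_card_cliques)
  next
    case False
    then show ?thesis using kr_eq_\<rho>[of "t + 2"] t by (simp add: w_def)
  qed
  have uw: "(real t - 1 + (real p + 2 - 2 * real t) * (real t + 1) * \<beta>) * g (t + 1) \<beta> = u t + w t"
    unfolding u_def w_def by (rule g_recurrence[OF pval p_pos t(1), symmetric])
  have "gap t = real n ^ (t + 2) * ((real t - 1 + (real p + 2 - 2 * real t) * (real t + 1) * \<beta>) * g (t + 1) \<beta> * \<rho> (t + 1))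
      - real n ^ (t + 2) * (u t * \<rho> t) - w t * \<rho> (t + 2) * real n ^ (t + 2)"
    unfolding gap_def k0 k1 k2 real_b u_def by (simp add: algebra_simps)
  then show ?thesis unfolding uw by (simp add: algebra_simps)
qed

lemma \<rho>_ineq:
  assumes "1 \<le> t" "t \<le> p"
  shows "w t * (\<rho> (t + 2) - \<rho> (t + 1)) \<le> u t * (\<rho> (t + 1) - \<rho> t)"
proof -
  have "0 < real n ^ (t + 2)" using n_pos by simp
  then have "0 \<le> u t * (\<rho> (t + 1) - \<rho> t) - w t * (\<rho> (t + 2) - \<rho> (t + 1))"
    using gap_nonneg[OF assms] unfolding gap_eq_\<rho>[OF assms] zero_le_mult_iff by linarith
  then show ?thesis by simp
qed

lemma \<rho>_Suc: "1 \<le> t \<Longrightarrow> t \<le> p \<Longrightarrow> \<rho> t \<le> \<rho> (t + 1)"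
  by (rule incseq_of_weighted_concave[OF u_pos w_nonneg w_p \<rho>_ineq])

lemma \<rho>_mono: 
  assumes "s \<le> t" "1 \<le> s" "t \<le> p + 1" shows "\<rho> s \<le> \<rho> t"
  using assms
proof (induction t rule: dec_induct)
  case (step t)
  then show ?case using \<rho>_Suc[of t] by simp
qed simp

lemma kr_1: "kr V E 1 = n"
proof -
  have "S = {}" if "S \<in> K 0" for S
    using that finite_in_cliques[OF that] by (simp add: cliques_def)
  then have "K 0 = {{}}" by (auto simp: cliques_def clique_def)
  moreover have "N {} = V" by (auto simp: common_nbrs_def)
  ultimately show ?thesis using sum_card_common_nbrs[of 0] card_V by simp
qed

lemma \<rho>_1: "\<rho> 1 = 1"
  using kr_eq_iff_\<rho>[of 1] kr_1 g_1[OF pval p_pos] by simp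

lemma sum_degree: "(\<Sum>v\<in>V. real (degree V E v)) = 2 * real (kr V E 2)"
proof -
  have "K 1 = (\<lambda>v. {v}) ` V" by (auto simp: cliques_def clique_def card_1_singleton_iff)
  then have "(\<Sum>T\<in>K 1. real (card (N T))) = (\<Sum>v\<in>V. real (degree V E v))"
    by (simp add: sum.reindex inj_on_def common_nbrs_def degree_def)
  then show ?thesis using sum_card_common_nbrs[of 1] by (simp add: numeral_2_eq_2)
qed

lemma kr_ge:
  assumes "1 \<le> r" shows "g r \<beta> * real n ^ r \<le> real (kr V E r)"
proof (cases "r \<le> p + 1")
  case True
  then have "1 \<le> \<rho> r" using \<rho>_mono[of 1 r] \<rho>_1 assms by simp
  then show ?thesis
    using g_gt_0[OF assms True] n_pos by (simp add: \<rho>_def)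
next
  case False
  then show ?thesis using g_eq_0[OF pval p_pos, of r] by simp
qed

text \<open>Monotonicity squeezes \<rho>_2 and \<rho>_3 between \<rho>_1 = 1 and \<rho>_r = 1. Above
  that, a zero increment on the right of \<open>\<rho>_ineq\<close> and a positive
  \<open>w t\<close> force the next increment to be 0. As \<open>w 1\<close> is 0, this can start
  only at t = 2.\<close>

lemma \<rho>_eq_1:
  assumes "3 \<le> r" "r \<le> p + 1" "\<rho> r = 1" "2 \<le> t" "t \<le> p"
  shows "\<rho> t = 1" "\<rho> (t + 1) = 1"
proof -
  have "\<rho> t = 1 \<and> \<rho> (t + 1) = 1"
    using assms(4,5)
  proof (induction t rule: dec_induct)
    case base
    have "\<rho> 1 \<le> \<rho> 2" "\<rho> 2 \<le> \<rho> 3" "\<rho> 3 \<le> \<rho> r"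
      using assms by (intro \<rho>_mono; simp)+
    then show ?case using \<rho>_1 assms(3) by simp
  next
    case (step t)
    then have IH: "\<rho> t = 1" "\<rho> (t + 1) = 1" by auto
    have "w t * (\<rho> (t + 2) - \<rho> (t + 1)) \<le> 0" using \<rho>_ineq[of t] IH step by simp
    then have "\<rho> (t + 2) \<le> 1" using w_pos[of t] IH step by (simp add: mult_le_0_iff)
    moreover have "\<rho> (t + 1) \<le> \<rho> (t + 2)" using step by (intro \<rho>_mono) auto
    ultimately show ?case using IH by simp
  qed
  then show "\<rho> t = 1" "\<rho> (t + 1) = 1" by auto
qed

text \<open>The ratios being 1 is used three times: at p and p + 1 it gives zero slack for
  p-cliques, at 2 it gives regularity, and at p + 1 it gives a (p+1)-clique. The parity statement
  supplies the condition that n and \<delta> are not both odd.\<close>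

lemma extremal_partition_if_kr_eq:
  assumes r: "3 \<le> r" "r \<le> p + 1" and eq: "real (kr V E r) = g r \<beta> * real n ^ r"
  shows "\<exists>P. extremal_partition V E n b p P \<and> cliques (P 0) E 3 = {}"
    and "even (n * (n - b))"
proof -
  have "\<rho> r = 1" using kr_eq_iff_\<rho>[of r] r eq by simp
  note \<rho>1 = \<rho>_eq_1[OF r this]
  have p2: "2 \<le> p" using r by simp
  have "gap p = 0" using gap_eq_\<rho>[of p] \<rho>1[of p] w_p p2 by simp
  then have tight: "slack p T = 0" if "T \<in> K p" for T
    using slack_eq_0_if_gap_eq_0[of p T] that p_pos by simp
  have "2 * real (kr V E 2) = real n * (real n - real b)"
    using kr_eq_iff_\<rho>[of 2] \<rho>1(1)[of 2] p2 g_2[OF pval p_pos]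
    by (simp add: real_b power2_eq_square algebra_simps)
  also have "\<dots> = real (n * (n - b))" using b_le by (simp add: of_nat_diff)
  finally have k2: "2 * real (kr V E 2) = real (n * (n - b))" .
  then have "real (2 * kr V E 2) = real (n * (n - b))" by simp
  then have "n * (n - b) = 2 * kr V E 2" by (simp only: of_nat_eq_iff)
  then show "even (n * (n - b))" by simp
  \<comment> \<open>The degree sum 2 k_2 equals n(n - b), and no degree is below n - b.\<close>
  have "(\<Sum>v\<in>V. real (degree V E v) - (real n - real b)) = 0"
    using sum_degree k2 b_le by (simp add: sum_subtractf card_V of_nat_diff)
  then have "\<forall>v\<in>V. real (degree V E v) - (real n - real b) = 0"
    by (subst (asm) sum_nonneg_eq_0_iff) (use degree_ge in auto)
  then have reg: "degree V E v = n - b" if "v \<in> V" for v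
    using that b_le by (metis eq_iff_diff_eq_0 of_nat_diff of_nat_eq_iff)
  have "0 < real (kr V E (p + 1))"
    using kr_eq_iff_\<rho>[of "p + 1"] \<rho>1(2)[of p] p2 g_gt_0[of "p + 1"] n_pos by simp
  then have "K (p + 1) \<noteq> {}" by (auto simp: kr_eq_card_cliques)
  then obtain S where "S \<in> K (p + 1)" by auto
  then show "\<exists>P. extremal_partition V E n b p P \<and> cliques (P 0) E 3 = {}"
    using extremal_partition_exists[OF p_pos reg tight _ n_le] by blast
qed

text \<open>With all gaps 0 the inequality for the increments is an equation, and downward induction
  from \<open>w p = 0\<close> makes every increment 0.\<close>

lemma kr_eq_if_extremal_partition:
  assumes P: "extremal_partition V E n b p P" "cliques (P 0) E 3 = {}" and r: "1 \<le> r" "r \<le> p + 1"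
  shows "real (kr V E r) = g r \<beta> * real n ^ r"
proof -
  have gap0: "u t * (\<rho> (t + 1) - \<rho> t) = w t * (\<rho> (t + 2) - \<rho> (t + 1))" if "1 \<le> t" "t \<le> p" for t
    using gap_eq_0_if_extremal_partition[OF P that] n_pos unfolding gap_eq_\<rho>[OF that] by simp
  have const: "\<rho> (t + 1) = \<rho> t" if "1 \<le> t" "t \<le> p" for t
    using that(2,1)
  proof (induction t rule: inc_induct)
    case base
    then show ?case using gap0[of p] w_p u_pos[of p] by simp
  next
    case (step t)
    then show ?case using gap0[of t] u_pos[of t] by simp
  qed
  have "\<rho> r = 1"
    using r
  proof (induction r rule: dec_induct)
    case base
    show ?case by (rule \<rho>_1)
  next
    case (step t)
    then show ?case using const[of t] by simp
  qed
  then show ?thesis using kr_eq_iff_\<rho>[OF r] by simp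
qed

end

section \<open>Family membership and feasibility as existence of a triangle-free partition\<close>

section \<open>The family and feasibility\<close>

text \<open>Multiplying out \<beta> = b/n turns the real equations for sizes and degrees into
  additive equations between natural numbers.\<close>

lemma family_witness_iff:
  assumes "0 < n" "\<delta> + b = n" "pval (real b / real n) = int p" "1 \<le> p"
  shows "family_witness n \<delta> V E P \<longleftrightarrow> sgraph V E \<and> card V = n \<and> extremal_partition V E n b p P \<and>
    (\<forall>H :: nat \<Rightarrow> nat \<Rightarrow> bool. regular_graph {0..<card (P 0)} H (real n - real p * real b) \<longrightarrow>
      kr (P 0) E 3 \<le> kr {0..<card (P 0)} H 3)"
proof -
  have \<delta>: "real \<delta> = real n - real b" using assms(2) by (metis add_diff_cancel_right' of_nat_add)
  have \<beta>: "1 - real \<delta> / real n = real b / real n" using assms(1) \<delta> by (simp add: field_simps)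
  have e: "(1 - x * (real b / real n)) * real n = real n - x * real b" "real b / real n * real n = real b" for x
    using assms(1) by (simp_all add: algebra_simps)
  have "real c = real n - real d * real b \<longleftrightarrow> c + d * b = n" for c d
    unfolding eq_diff_eq of_nat_mult[symmetric] of_nat_add[symmetric] of_nat_eq_iff by (rule refl)
  then show ?thesis
    unfolding family_witness_def extremal_partition_def Let_def \<beta> assms(3) nat_int e of_nat_eq_iff
    by (auto simp only: conj_assoc)
qed

text \<open>Forwards, a copy of the graph on \<open>{0..<n}\<close> lets feasibility apply to its
  own partition. Backwards, a triangle-free \<open>P 0\<close> is trivially a minimum, and it
  competes with every other witness.\<close>

lemma feasible_in_family_iff:
  assumes fam: "family_defined n \<delta>" and G: "sgraph V E" "card V = n"
    and n: "0 < n" "\<delta> + b = n" "pval (real b / real n) = int p" "1 \<le> p"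
  shows "feasible n \<delta> \<and> in_family n \<delta> V E \<longleftrightarrow>
    (\<exists>P. extremal_partition V E n b p P \<and> cliques (P 0) E 3 = {})"
proof
  have finV: "finite V" using G(1) by (simp add: sgraph_def)
  have fin0: "extremal_partition V E n b p P \<Longrightarrow> finite (P 0)" for P
    using finite_extremal_partition_0[OF finV n(4)] .
  {
    assume "feasible n \<delta> \<and> in_family n \<delta> V E"
    then obtain P where feas: "feasible n \<delta>" and P: "family_witness n \<delta> V E P"
      by (auto simp: in_family_def)
    note P = P[unfolded family_witness_iff[OF n]]
    obtain f where f: "bij_betw f {0..<n} V"
      using finV G(2) by (metis ex_bij_betw_nat_finite)
    define E' where "E' = pullback {0..<n} f E"
    define P' where "P' i = {x\<in>{0..<n}. f x \<in> P i}" for i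
    have P': "extremal_partition {0..<n} E' n b p P'" and f0: "bij_betw f (P' 0) (P 0)"
      using extremal_partition_pullback[OF _ n(4) f, of E n b P] P unfolding E'_def P'_def by auto
    have c0: "card (P' 0) = card (P 0)" using f0 by (rule bij_betw_same_card)
    have k0: "kr (P' 0) E' 3 = kr (P 0) E 3"
      by (rule kr_bij_cong[OF f0]) (auto simp: E'_def P'_def pullback_def)
    have "family_witness n \<delta> {0..<n} E' P'"
      unfolding family_witness_iff[OF n] c0 k0 using P P' G(1) by (auto simp: E'_def intro: sgraph_pullback)
    then have "kr (P 0) E 3 = 0" using feas k0 unfolding feasible_def by auto
    then show "\<exists>P. extremal_partition V E n b p P \<and> cliques (P 0) E 3 = {}"
      using P fin0 kr_eq_0_iff by blast
  next
    assume "\<exists>P. extremal_partition V E n b p P \<and> cliques (P 0) E 3 = {}"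
    then obtain P where P: "extremal_partition V E n b p P" and k: "kr (P 0) E 3 = 0"
      using fin0 kr_eq_0_iff by blast
    have "family_witness n \<delta> V E P" unfolding family_witness_iff[OF n] using G P k by simp
    moreover have "kr (P' 0) E' 3 = 0" if "family_witness n \<delta> {0..<n} E' P'"
      for E' :: "nat \<Rightarrow> nat \<Rightarrow> bool" and P'
    proof -
      note W = that[unfolded family_witness_iff[OF n]]
      \<comment> \<open>Both sizes are n - (p-1)b, so the two regular graphs have the same order and
        can be compared.\<close>
      have c0: "card (P' 0) = card (P 0)"
        using W P unfolding extremal_partition_def by (metis add_right_cancel)
      obtain f where f: "bij_betw f {0..<card (P 0)} (P 0)"
        using fin0[OF P] by (metis ex_bij_betw_nat_finite)
      let ?A = "{0..<card (P 0)}"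
      \<comment> \<open>The copy of G[P 0] is regular of the required degree and triangle-free, so
        minimality leaves \<open>P' 0\<close> without triangles.\<close>
      define H where "H = pullback ?A f E"
      have "degree ?A H v + p * b = n" if "v \<in> ?A" for v
      proof -
        have "degree ?A H v = degree (P 0) E (f v)"
          using that by (intro degree_bij_cong[OF f]) (auto simp: H_def pullback_def)
        moreover have "f v \<in> P 0" using f that by (auto simp: bij_betw_def)
        ultimately show ?thesis using P unfolding extremal_partition_def by simp
      qed
      then have "real (degree ?A H v) = real n - real p * real b" if "v \<in> ?A" for v
        using that by (metis add_diff_cancel_right' of_nat_add of_nat_mult)
      then have "regular_graph ?A H (real n - real p * real b)"
        unfolding regular_graph_def H_def using sgraph_pullback[OF _ G(1), of ?A f] by simp
      then have "kr (P' 0) E' 3 \<le> kr ?A H 3" using W c0 by simp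
      also have "\<dots> = kr (P 0) E 3"
        by (rule kr_bij_cong[OF f]) (auto simp: H_def pullback_def)
      finally show ?thesis using k by simp
    qed
    ultimately show "feasible n \<delta> \<and> in_family n \<delta> V E"
      using fam unfolding feasible_def in_family_def by blast
  }
qed

theorem mainTheorem2:
  fixes V :: "'a set" and E :: "'a \<Rightarrow> 'a \<Rightarrow> bool" and n \<delta> :: nat and \<beta> :: real
  assumes "sgraph V E" and "card V = n" and "0 < n" and "0 < \<delta>"
    and "\<beta> = 1 - real \<delta> / real n"
    and "min_degree_is V E \<delta>"
    and "clique_free V E (nat (pval \<beta>) + 2)"
  shows "(\<forall>r::nat. 1 \<le> r \<longrightarrow> real (kr V E r) \<ge> g r \<beta> * real n ^ r)
    \<and> (\<forall>r::nat. 3 \<le> r \<and> r \<le> nat (pval \<beta>) + 1 \<longrightarrow>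
         (real (kr V E r) = g r \<beta> * real n ^ r \<longleftrightarrow> feasible n \<delta> \<and> in_family n \<delta> V E))"
proof -
  interpret simple_graph V E by unfold_locales (rule assms(1))
  obtain v where v: "v \<in> V" "degree V E v = \<delta>" and deg: "\<And>v. v \<in> V \<Longrightarrow> \<delta> \<le> degree V E v"
    using assms(6) unfolding min_degree_is_def by blast
  define b where "b = n - \<delta>"
  \<comment> \<open>A vertex is its own non-neighbour, which gives \<delta> < n and hence b >
    0.\<close>
  have "v \<in> nonN v" using v(1) by (simp add: non_nbrs_def)
  then have "0 < card (nonN v)" by (auto simp: card_gt_0_iff)
  then have "\<delta> < n" using card_nonN[OF v(1)] v(2) assms(2) by simp
  then have b: "0 < b" "b < n" "\<delta> + b = n" and \<delta>: "\<delta> = n - b" using assms(4) by (auto simp: b_def)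
  have "real \<delta> = real n - real b" unfolding b(3)[symmetric] by simp
  then have \<beta>: "\<beta> = real b / real n"
    unfolding assms(5) using assms(3) by (simp add: field_simps)
  obtain p where p: "pval (real b / real n) = int p" "1 \<le> p" "p * b < n" "n \<le> (p + 1) * b"
    using pval_ratio[OF b(1,2)] .
  have np: "nat (pval \<beta>) = p" unfolding \<beta> p(1) by simp
  interpret min_degree_graph V E n b p \<beta>
  proof
    show "card (nonN x) \<le> b" if "x \<in> V" for x
      using card_nonN[OF that] deg[OF that] assms(2) by (simp add: b_def)
    show "K (p + 2) = {}" using assms(7) unfolding np clique_free_def cliques_def by blast
  qed (use assms(2,3) b p \<beta> in auto)
  have "real (kr V E r) = g r \<beta> * real n ^ r \<longleftrightarrow> feasible n \<delta> \<and> in_family n \<delta> V E"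
    if r: "3 \<le> r" "r \<le> p + 1" for r
  proof
    assume eq: "real (kr V E r) = g r \<beta> * real n ^ r"
    note ext = extremal_partition_if_kr_eq[OF r eq]
    have "family_defined n \<delta>"
      using ext(2) assms(4) \<open>\<delta> < n\<close> unfolding family_defined_def \<delta>[symmetric] by simp
    then show "feasible n \<delta> \<and> in_family n \<delta> V E"
      using feasible_in_family_iff[OF _ assms(1-3) b(3) p(1,2)] ext(1) by blast
  next
    assume *: "feasible n \<delta> \<and> in_family n \<delta> V E"
    then have "family_defined n \<delta>" by (simp add: feasible_def)
    then obtain P where "extremal_partition V E n b p P" "cliques (P 0) E 3 = {}"
      using feasible_in_family_iff[OF _ assms(1-3) b(3) p(1,2)] * by blast
    then show "real (kr V E r) = g r \<beta> * real n ^ r"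
      using kr_eq_if_extremal_partition r by simp
  qed
  then show ?thesis unfolding np using kr_ge by blast
qed

end
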